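(* Let $F$ be a finite nonempty connected linear $s$-uniform hypergraph whose line graph is a cograph. Suppose $R_s(F)=d\le s-1$ and that $\operatorname{Comp}(s,d)$ holds. Then exactly one of the following occurs. (1) (Full row rank.) $|E(F)|=d$ and $\operatorname{rank}N(F)=d$. (2) (Affine-plane subsystem.) There are a unique affine plane $\Pi$ of order $s$ and an integer $h$ with $0\le h\le d$ such that $F\subseteq \Pi$, $F$ contains every line in $s+1-h$ parallel classes of $\Pi$, and $F$ contains exactly $M=d-h$ additional lines from the remaining $h$ classes. If $d>0$, then $1\le h\le d$; if $d=0$, then $h=0$ and $F=\Pi$. Conversely, for $0\le d\le s-1$ such that $\operatorname{Comp}(s,d)$ holds, every nonempty connected linear $s$-uniform hypergraph $F$ with cograph line graph that is of the form described in (1) or (2) satisfies $R_s(F)=d$.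
   Context: A hypergraph is $s$-uniform if every edge has exactly $s$ vertices, and linear if any two distinct edges share at most one vertex. The line graph has the edges of the hypergraph as vertices, two distinct edges being adjacent when they intersect. A cograph is a graph with no induced path on four vertices. Connected hypergraphs have connected line graph and no isolated vertices. $N(F)$ is the edge--vertex incidence matrix (rows indexed by edges; isolated vertices removed), and the incidence-rank defect is $$R_s(F)=(s+1)\operatorname{rank}_{\mathbb R}N(F)-s|E(F)|.$$ An $a$-net of order $s$ is a linear $s$-uniform incidence structure on $s^2$ points whose lines are divided into $a$ parallel classes; each class consists of $s$ disjoint lines partitioning the point set, and lines from different classes meet in exactly one point. Its deficiency is $s+1-a$. An affine plane of order $s$ is an $(s+1)$-net of order $s$. $F\subseteq\Pi$ means that every edge of $F$ is a line of $\Pi$. Completion hypothesis: for $0\le d\le s-1$, $\operatorname{Comp}(s,d)$ means that (i) every net of order $s$ and deficiency at most $d$ embeds in an affine plane of order $s$ (on the same point set, its parallel classes being parallel classes of the plane), and (ii) $s>(d-1)^2$. *)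

theory Defs
  imports Complex_Main "HOL-Library.Function_Algebras" "HOL-Library.Disjoint_Sets"
begin

section \<open>Hypergraphs\<close>

text \<open>A hypergraph is given by its vertex set \<open>V\<close> and its set \<open>E\<close> of edges. Vertex sets are
  finite throughout.\<close>

definition hypergraph :: "'a set \<Rightarrow> 'a set set \<Rightarrow> bool" where
  "hypergraph V E \<longleftrightarrow> finite V \<and> \<Union>E \<subseteq> V"

definition uniform :: "nat \<Rightarrow> 'a set set \<Rightarrow> bool" where
  "uniform s E \<longleftrightarrow> (\<forall>e\<in>E. card e = s)"

definition linear_edges :: "'a set set \<Rightarrow> bool" where
  "linear_edges E \<longleftrightarrow> (\<forall>e\<in>E. \<forall>f\<in>E. e \<noteq> f \<longrightarrow> card (e \<inter> f) \<le> 1)"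

text \<open>A simple graph on a vertex set \<open>X\<close> is represented by its symmetric irreflexive adjacency
  relation, which is contained in \<open>X \<times> X\<close>.\<close>

definition line_graph :: "'a set set \<Rightarrow> 'a set rel" where
  "line_graph E = {(e, f). e \<in> E \<and> f \<in> E \<and> e \<noteq> f \<and> e \<inter> f \<noteq> {}}"

definition connected_graph :: "'b set \<Rightarrow> 'b rel \<Rightarrow> bool" where
  "connected_graph X G \<longleftrightarrow> (\<forall>x\<in>X. \<forall>y\<in>X. (x, y) \<in> G\<^sup>*)"

definition cograph :: "'b set \<Rightarrow> 'b rel \<Rightarrow> bool" where
  "cograph X G \<longleftrightarrow>
     \<not> (\<exists>a\<in>X. \<exists>b\<in>X. \<exists>c\<in>X. \<exists>d\<in>X. distinct [a, b, c, d] \<and>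
          (a, b) \<in> G \<and> (b, c) \<in> G \<and> (c, d) \<in> G \<and>
          (a, c) \<notin> G \<and> (a, d) \<notin> G \<and> (b, d) \<notin> G)"

definition connected_hypergraph :: "'a set \<Rightarrow> 'a set set \<Rightarrow> bool" where
  "connected_hypergraph V E \<longleftrightarrow> V = \<Union>E \<and> connected_graph E (line_graph E)"

section \<open>Incidence rank\<close>

text \<open>Functions \<open>'b \<Rightarrow> real\<close> form a real vector space under pointwise operations; the addition
  is the one from \<open>Function_Algebras\<close>.\<close>

definition fun_scale :: "real \<Rightarrow> ('b \<Rightarrow> real) \<Rightarrow> ('b \<Rightarrow> real)" where
  "fun_scale c f = (\<lambda>x. c * f x)"

lemma vector_space_fun_scale: "vector_space (fun_scale :: real \<Rightarrow> ('b \<Rightarrow> real) \<Rightarrow> _)"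
  by unfold_locales (auto simp: fun_scale_def fun_eq_iff algebra_simps)

text \<open>The real rank of the matrix with rows indexed by \<open>I\<close>, columns indexed by \<open>J\<close> and entries
  \<open>A i j\<close>, as the dimension of its row space. Rows are extended by zero outside \<open>J\<close>.\<close>

definition matrix_rank :: "'i set \<Rightarrow> 'j set \<Rightarrow> ('i \<Rightarrow> 'j \<Rightarrow> real) \<Rightarrow> nat" where
  "matrix_rank I J A =
     vector_space.dim fun_scale ((\<lambda>i j. if j \<in> J then A i j else 0) ` I)"

definition incidence :: "'a set \<Rightarrow> 'a \<Rightarrow> real" where
  "incidence e v = (if v \<in> e then 1 else 0)"

text \<open>The columns range over \<open>\<Union>E\<close>, i.e. over the non-isolated vertices.\<close>

definition incidence_rank :: "'a set set \<Rightarrow> nat" where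
  "incidence_rank E = matrix_rank E (\<Union>E) incidence"

definition rank_defect :: "nat \<Rightarrow> 'a set set \<Rightarrow> int" where
  "rank_defect s E = (int s + 1) * int (incidence_rank E) - int s * int (card E)"

section \<open>Nets and affine planes\<close>

text \<open>A net is given by its point set \<open>P\<close> and its set \<open>C\<close> of parallel classes, each of which is a
  set of lines; thus \<open>\<Union>C\<close> is the set of lines.\<close>

definition net :: "nat \<Rightarrow> nat \<Rightarrow> 'a set \<Rightarrow> 'a set set set \<Rightarrow> bool" where
  "net s a P C \<longleftrightarrow>
     finite P \<and> card P = s\<^sup>2 \<and> uniform s (\<Union>C) \<and> linear_edges (\<Union>C) \<and>
     finite C \<and> card C = a \<and> disjoint C \<and>
     (\<forall>K\<in>C. partition_on P K \<and> card K = s) \<and>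
     (\<forall>K\<in>C. \<forall>L\<in>C. K \<noteq> L \<longrightarrow> (\<forall>k\<in>K. \<forall>l\<in>L. card (k \<inter> l) = 1))"

definition affine_plane :: "nat \<Rightarrow> 'a set \<Rightarrow> 'a set set set \<Rightarrow> bool" where
  "affine_plane s P C \<longleftrightarrow> net s (s + 1) P C"

text \<open>The completion hypothesis, used for \<open>d < s\<close>. It is a statement about all nets of order \<open>s\<close>;
  since nets are finite, it suffices to let the points be natural numbers, which keeps the
  hypothesis independent of the vertex type of the hypergraph. For \<open>d = 0\<close> the bound reads
  \<open>s > 1\<close>, so the subtractions are taken over the integers.\<close>

definition Comp :: "nat \<Rightarrow> nat \<Rightarrow> bool" where
  "Comp s d \<longleftrightarrow>
     (\<forall>(P :: nat set) C a. net s a P C \<and> int s + 1 - int a \<le> int d \<longrightarrow>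
        (\<exists>C'. affine_plane s P C' \<and> C \<subseteq> C')) \<and>
     int s > (int d - 1)\<^sup>2"

section \<open>The two alternatives\<close>

definition full_row_rank :: "nat \<Rightarrow> 'a set set \<Rightarrow> bool" where
  "full_row_rank d E \<longleftrightarrow> card E = d \<and> incidence_rank E = d"

text \<open>The set \<open>D\<close> collects the \<open>s + 1 - h\<close> parallel classes that are contained in the hypergraph.\<close>

definition plane_subsystem ::
    "nat \<Rightarrow> nat \<Rightarrow> 'a set \<Rightarrow> 'a set set \<Rightarrow> 'a set \<Rightarrow> 'a set set set \<Rightarrow> nat \<Rightarrow> bool" where
  "plane_subsystem s d V E P C h \<longleftrightarrow>
     h \<le> d \<and> E \<subseteq> \<Union>C \<and>
     (\<exists>D\<subseteq>C. card D = s + 1 - h \<and> \<Union>D \<subseteq> E \<and> card (E \<inter> \<Union>(C - D)) = d - h) \<and>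
     (d > 0 \<longrightarrow> 1 \<le> h) \<and>
     (d = 0 \<longrightarrow> h = 0 \<and> V = P \<and> E = \<Union>C)"

end

theory Submission
  imports Defs
begin

text \<open>Give the row space of a set \<open>X\<close> of edges the standard inner product and let \<open>u\<close> be the vector
  in it with inner product \<open>1\<close> with every row, if it exists; its squared norm \<open>t\<close> is the weight of \<open>X\<close>.
  If all edges of \<open>X\<close> meet all edges of \<open>Y\<close>, then \<open>t\<^sub>X t\<^sub>Y \<le> 1\<close> by Cauchy-Schwarz, ranks add up
  if \<open>t\<^sub>X t\<^sub>Y < 1\<close>, and otherwise exactly one dimension is lost, along \<open>u\<^sub>X\<close>. A cograph with
  at least two vertices is a disjoint union or a join, so both the weight and the defect can be computed
  recursively. The recursion gives \<open>R \<ge> s min(t, 2)\<close> as long as no parallel class of \<open>s\<close> edges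
  meets all remaining edges. Hence a hypergraph with dependent rows and \<open>R < s\<close> contains \<open>b\<close> such
  classes, where \<open>s + 1 - b \<le> R\<close>. They form a net which is completed by assumption, and Bruck's counting
  argument shows that each remaining edge is a line of the completion and that the completion is unique.\<close>

section \<open>Dimensions of unions\<close>

text \<open>A critical join, where the weights multiply to \<open>1\<close>, costs
  \<open>s + 1\<close> in the defect, and the question is which sides are too cheap to pay for it. A
  disjoint family of \<open>s\<close> edges has weight \<open>1\<close> but defect only
  \<open>s\<close>, so joining it to another family of weight \<open>1\<close> lowers the defect by
  one. The third clause of \<open>controlled\<close> says that nothing else of weight
  \<open>1\<close> is as cheap. The obstacle is that a weight above \<open>1\<close> may be balanced
  by one below \<open>1\<close>, where this comparison says nothing. An auxiliary edge
  \<open>e\<close> that meets all edges under consideration rules this out: it forces both weights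
  at a critical join to be \<open>1\<close>, and it also prevents a full class inside one side of a
  disjoint union. Within one side of the outermost join, any edge of the opposite side can serve as
  \<open>e\<close>. Connectedness makes the outermost decomposition a join. There no such edge is at
  hand, and unequal weights \<open>a\<close> and \<open>1 / a\<close> are handled by the strict
  inequality \<open>a + 1 / a > 2\<close>.\<close>

context vector_space
begin

text \<open>A linear relation among the two bases splits into a vector of \<open>span A\<close> and
  its negative in \<open>span B\<close>, so both halves vanish. The ambient function space may be
  infinite-dimensional; the finite generating sets carry the count.\<close>

lemma dim_Un_if_span_Int_trivial:
  assumes "finite A" "finite B" "span A \<inter> span B \<subseteq> {0}"
  shows "dim (A \<union> B) = dim A + dim B"
proof -
  obtain A' where A': "A' \<subseteq> A" "independent A'" "A \<subseteq> span A'" "card A' = dim A"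
    using basis_exists by blast
  obtain B' where B': "B' \<subseteq> B" "independent B'" "B \<subseteq> span B'" "card B' = dim B"
    using basis_exists by blast
  have fin: "finite A'" "finite B'"
    using A'(1) B'(1) assms(1,2) by (auto intro: finite_subset)
  have eqA: "span A' = span A" and eqB: "span B' = span B"
    using A' B' by (auto simp: span_eq intro: span_base dest: subsetD)
  have zero: "0 \<notin> A'" "0 \<notin> B'"
    using A' B' dependent_zero by auto
  have disj: "A' \<inter> B' = {}"
    using assms(3) zero eqA eqB span_base by blast
  have "independent (A' \<union> B')"
  proof
    assume "dependent (A' \<union> B')"
    then obtain w where w: "\<exists>v\<in>A' \<union> B'. w v \<noteq> 0" "(\<Sum>v\<in>A' \<union> B'. w v *s v) = 0"
      using dependent_finite[of "A' \<union> B'"] fin by auto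
    define a where "a = (\<Sum>v\<in>A'. w v *s v)"
    define b where "b = (\<Sum>v\<in>B'. w v *s v)"
    have ab: "a + b = 0"
      using w(2) unfolding a_def b_def sum.union_disjoint[OF fin disj] .
    have "a \<in> span A" "b \<in> span B"
      unfolding a_def b_def eqA[symmetric] eqB[symmetric]
      by (simp_all add: span_sum span_scale span_base)
    moreover have "a = - b"
      using ab by (simp add: eq_neg_iff_add_eq_0)
    ultimately have "a \<in> span A \<inter> span B"
      by (simp add: span_neg)
    then have a0: "a = 0" and b0: "b = 0"
      using assms(3) ab by auto
    have "\<forall>v\<in>A'. w v = 0" "\<forall>v\<in>B'. w v = 0"
      using A'(2) B'(2) a0 b0 fin unfolding a_def b_def by (auto simp: dependent_finite)
    with w(1) show False by auto
  qed
  moreover have "span (A' \<union> B') = span (A \<union> B)"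
    using eqA eqB by (simp add: span_Un)
  ultimately have "dim (A \<union> B) = card (A' \<union> B')"
    by (metis dim_span_eq_card_independent dim_span)
  also have "\<dots> = dim A + dim B"
    using fin disj A'(4) B'(4) by (simp add: card_Un_disjoint)
  finally show ?thesis .
qed

text \<open>Extending \<open>u\<close> to a basis of \<open>span A\<close> and then dropping it
  reduces the claim to the case of trivial intersection. The joint span does not change, because
  \<open>B\<close> still supplies \<open>u\<close>.\<close>

lemma dim_Un_if_span_Int_line:
  assumes "finite A" "finite B" "u \<noteq> 0" "u \<in> span A" "u \<in> span B" "span A \<inter> span B \<subseteq> span {u}"
  shows "dim (A \<union> B) + 1 = dim A + dim B"
proof -
  obtain A' where A': "{u} \<subseteq> A'" "A' \<subseteq> span A" "independent A'" "span A \<subseteq> span A'"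
    using maximal_independent_subset_extend[of "{u}" "span A"] assms by auto
  have fin: "finite A'"
    using independent_span_bound[OF assms(1) A'(3) A'(2)] by auto
  have eqA: "span A' = span A"
    using A' by (metis span_minimal subspace_span subset_antisym)
  have cardA: "card A' = dim A"
    using A'(3) eqA by (metis dim_span_eq_card_independent dim_span)
  have "span (A' - {u}) \<inter> span B \<subseteq> {0}"
  proof
    fix v assume v: "v \<in> span (A' - {u}) \<inter> span B"
    then have "v \<in> span A"
      using eqA span_mono[of "A' - {u}" A'] by auto
    with v assms(6) obtain c where c: "v = c *s u"
      by (auto simp: span_singleton)
    have "c = 0"
    proof (rule ccontr)
      assume "c \<noteq> 0"
      then have "u = inverse c *s v"
        using c by simp
      then have "u \<in> span (A' - {u})"
        using v span_scale by auto
      then show False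
        using A' by (auto simp: dependent_def)
    qed
    with c show "v \<in> {0}" by simp
  qed
  then have "dim ((A' - {u}) \<union> B) = dim (A' - {u}) + dim B"
    using dim_Un_if_span_Int_trivial[of "A' - {u}" B] fin assms(2) by blast
  moreover have "dim (A' - {u}) = card (A' - {u})"
    using A'(3) independent_mono by (intro dim_eq_card_independent) blast
  moreover have "card (A' - {u}) + 1 = dim A"
    using A'(1) fin cardA by (metis One_nat_def Suc_eq_plus1 card.remove insert_subset)
  moreover have "span ((A' - {u}) \<union> B) = span (A \<union> B)"
  proof -
    have "u \<in> span ((A' - {u}) \<union> B)"
      using assms(5) span_mono[of B "(A' - {u}) \<union> B"] by auto
    then have "span ((A' - {u}) \<union> B) = span (insert u ((A' - {u}) \<union> B))"
      by (simp add: span_redundant)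
    also have "insert u ((A' - {u}) \<union> B) = A' \<union> B"
      using A'(1) by auto
    finally show ?thesis
      using eqA by (simp add: span_Un)
  qed
  ultimately show ?thesis
    by (metis add.assoc add.commute dim_span)
qed

end

interpretation fun_vs: vector_space "fun_scale :: real \<Rightarrow> ('b \<Rightarrow> real) \<Rightarrow> _"
  by (rule vector_space_fun_scale)

text \<open>Rows vanish outside the union of \<open>X\<close> anyway, so cutting off columns has no
  effect. The ranks of different families thus become dimensions in one common space.\<close>

lemma incidence_rank_eq_dim: "incidence_rank X = fun_vs.dim (incidence ` X)"
proof -
  have "(\<lambda>i j. if j \<in> \<Union>X then incidence i j else 0) ` X = incidence ` X"
    by (rule image_cong) (auto simp: fun_eq_iff incidence_def)
  then show ?thesis
    by (simp add: incidence_rank_def matrix_rank_def)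
qed

lemma inj_incidence: "inj incidence"
proof (rule injI)
  fix e f :: "'a set"
  assume "incidence e = incidence f"
  then have "\<And>v. (v \<in> e) = (v \<in> f)"
    by (metis incidence_def zero_neq_one)
  then show "e = f" by blast
qed

lemma incidence_rank_le_card: "finite X \<Longrightarrow> incidence_rank X \<le> card X"
  unfolding incidence_rank_eq_dim
  by (metis card_image fun_vs.dim_le_card' finite_imageI inj_incidence inj_on_subset subset_UNIV)

section \<open>Disjoint unions and joins\<close>

definition separated :: "'a set set \<Rightarrow> 'a set set \<Rightarrow> bool" where
  "separated X Y \<longleftrightarrow> (\<forall>x\<in>X. \<forall>y\<in>Y. x \<inter> y = {})"

text \<open>Disjointness has to be demanded here, since a nonempty edge meets itself. For
  \<open>separated\<close> it follows from the edges being nonempty, see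
  \<open>separated_disjoint\<close>.\<close>

definition joined :: "'a set set \<Rightarrow> 'a set set \<Rightarrow> bool" where
  "joined X Y \<longleftrightarrow> X \<inter> Y = {} \<and> (\<forall>x\<in>X. \<forall>y\<in>Y. x \<inter> y \<noteq> {})"

lemma joined_sym: "joined X Y \<Longrightarrow> joined Y X"
  unfolding joined_def by blast

lemma separated_sym: "separated X Y \<Longrightarrow> separated Y X"
  unfolding separated_def by blast

lemma joined_mono: "joined X Y \<Longrightarrow> X' \<subseteq> X \<Longrightarrow> Y' \<subseteq> Y \<Longrightarrow> joined X' Y'"
  unfolding joined_def by blast

section \<open>Inner product and weight of a family of edges\<close>

locale uniform_linear =
  fixes s :: nat and E :: "'a set set"
  assumes finite_E: "finite E" and s_pos: "0 < s"
    and uniform_E: "uniform s E" and linear_E: "linear_edges E"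
begin

text \<open>The sum runs over the points of the whole of \<open>E\<close>, so that one form serves
  all subfamilies. It is definite only on functions vanishing outside these points, in particular on
  all row spaces (\<open>sp_ip_self_eq_0\<close>).\<close>

definition ip :: "('a \<Rightarrow> real) \<Rightarrow> ('a \<Rightarrow> real) \<Rightarrow> real" where
  "ip f g = (\<Sum>p\<in>\<Union>E. f p * g p)"

lemma card_edge: "e \<in> E \<Longrightarrow> card e = s"
  using uniform_E by (auto simp: uniform_def)

lemma finite_edge: "e \<in> E \<Longrightarrow> finite e"
  using card_edge s_pos card_ge_0_finite by metis

lemma edge_nonempty: "e \<in> E \<Longrightarrow> e \<noteq> {}"
  using card_edge s_pos by fastforce

lemma finite_points: "finite (\<Union>E)"
  using finite_E finite_edge by auto

lemma card_Int_edge: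
  assumes "e \<in> E" "f \<in> E" "e \<noteq> f" "e \<inter> f \<noteq> {}"
  shows "card (e \<inter> f) = 1"
proof -
  have "card (e \<inter> f) \<le> 1" "card (e \<inter> f) \<noteq> 0"
    using assms linear_E finite_edge by (auto simp: linear_edges_def)
  then show ?thesis by simp
qed

lemma ip_add_left: "ip (f + g) h = ip f h + ip g h"
  and ip_add_right: "ip h (f + g) = ip h f + ip h g"
  and ip_diff_left: "ip (f - g) h = ip f h - ip g h"
  and ip_diff_right: "ip h (f - g) = ip h f - ip h g"
  and ip_scale_left: "ip (fun_scale c f) h = c * ip f h"
  and ip_scale_right: "ip h (fun_scale c f) = c * ip h f"
  and ip_zero_left: "ip 0 h = 0"
  and ip_zero_right: "ip h 0 = 0"
  by (auto simp: ip_def fun_scale_def algebra_simps sum.distrib sum_subtractf sum_distrib_left)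

lemmas ip_simps = ip_add_left ip_add_right ip_diff_left ip_diff_right ip_scale_left ip_scale_right
  ip_zero_left ip_zero_right

lemma ip_commute: "ip f g = ip g f"
  by (simp add: ip_def mult.commute)

lemma ip_ge_0: "0 \<le> ip f f"
  unfolding ip_def by (intro sum_nonneg) auto

lemma ip_incidence:
  assumes "e \<in> E"
  shows "ip (incidence e) (incidence f) = card (e \<inter> f)"
proof -
  have "ip (incidence e) (incidence f) = (\<Sum>p\<in>\<Union>E. if p \<in> e \<inter> f then 1 else 0)"
    unfolding ip_def by (intro sum.cong) (auto simp: incidence_def)
  also have "\<dots> = (\<Sum>p\<in>e \<inter> f. 1)"
  proof -
    have "\<Union>E \<inter> (e \<inter> f) = e \<inter> f" using assms by auto
    then show ?thesis
      using finite_points sum.inter_restrict[of "\<Union>E" "\<lambda>_. 1::real" "e \<inter> f"] by simp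
  qed
  finally show ?thesis by simp
qed

lemma ip_incidence_joined:
  assumes "joined X Y" "X \<subseteq> E" "Y \<subseteq> E" "x \<in> X" "y \<in> Y"
  shows "ip (incidence x) (incidence y) = 1"
proof -
  have "card (x \<inter> y) = 1"
    using assms by (intro card_Int_edge) (auto simp: joined_def)
  then show ?thesis
    using assms by (subst ip_incidence) auto
qed

abbreviation sp :: "'a set set \<Rightarrow> ('a \<Rightarrow> real) set" where
  "sp X \<equiv> fun_vs.span (incidence ` X)"

lemma ip_eq_on_sp:
  assumes "v \<in> sp X" "\<And>x. x \<in> X \<Longrightarrow> ip (incidence x) f = ip (incidence x) g"
  shows "ip v f = ip v g"
  using assms(1)
proof (induction rule: fun_vs.span_induct_alt)
  case base
  show ?case by (simp only: ip_simps)
next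
  case (step c x y)
  then have "ip x f = ip x g" using assms(2) by auto
  with step show ?case by (simp only: ip_simps)
qed

lemma sp_vanishes_outside:
  assumes "v \<in> sp X" "X \<subseteq> E" "p \<notin> \<Union>E"
  shows "v p = 0"
  using assms(1)
  by (induction rule: fun_vs.span_induct_alt) (use assms in \<open>auto simp: fun_scale_def incidence_def\<close>)

lemma sp_ip_self_eq_0:
  assumes "v \<in> sp X" "X \<subseteq> E" "ip v v = 0"
  shows "v = 0"
proof
  fix p
  show "v p = 0 p"
  proof (cases "p \<in> \<Union>E")
    case True
    then have "v p * v p = 0"
      using assms(3) finite_points sum_nonneg_eq_0_iff[of "\<Union>E" "\<lambda>p. v p * v p"] unfolding ip_def by auto
    then show ?thesis by simp
  next
    case False
    then show ?thesis using sp_vanishes_outside assms by auto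
  qed
qed

text \<open>The difference lies in the span and is orthogonal to all generators, hence to
  itself.\<close>

lemma sp_eqI:
  assumes "v \<in> sp X" "w \<in> sp X" "X \<subseteq> E" "\<And>x. x \<in> X \<Longrightarrow> ip (incidence x) v = ip (incidence x) w"
  shows "v = w"
proof -
  have d: "v - w \<in> sp X"
    using assms fun_vs.span_diff by blast
  then have "ip (v - w) v = ip (v - w) w"
    using ip_eq_on_sp assms(4) by blast
  then have "v - w = 0"
    using d assms(3) by (intro sp_ip_self_eq_0[of "v - w" X]) (auto simp: ip_simps)
  then show ?thesis by simp
qed

text \<open>The vector \<open>u\<close> represents the functional ``sum of the coefficients'' on the row space.
  It is the projection onto that space of any line meeting all members of \<open>X\<close>.\<close>

definition unit_vec :: "'a set set \<Rightarrow> ('a \<Rightarrow> real) \<Rightarrow> bool" where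
  "unit_vec X u \<longleftrightarrow> u \<in> sp X \<and> (\<forall>x\<in>X. ip (incidence x) u = 1)"

text \<open>A relation instead of a function, since \<open>u\<close> need not exist: a linear
  relation among the rows with nonzero coefficient sum excludes it. For
  \<open>X \<subseteq> E\<close> the value is unique by \<open>sp_eqI\<close>. If the rows are
  independent, it is the sum of all entries of the inverse of their Gram matrix.\<close>

definition weight :: "'a set set \<Rightarrow> real \<Rightarrow> bool" where
  "weight X t \<longleftrightarrow> (\<exists>u. unit_vec X u \<and> ip u u = t)"

lemma unit_vec_nonzero: "unit_vec X u \<Longrightarrow> X \<noteq> {} \<Longrightarrow> u \<noteq> 0"
  by (auto simp: unit_vec_def ip_simps)

lemma weight_pos:
  assumes "weight X t" "X \<noteq> {}" "X \<subseteq> E"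
  shows "0 < t"
proof -
  obtain u where u: "unit_vec X u" "ip u u = t"
    using assms by (auto simp: weight_def)
  then have "t \<noteq> 0"
    using unit_vec_nonzero[OF u(1) assms(2)] sp_ip_self_eq_0 assms(3) unfolding unit_vec_def by blast
  then show ?thesis using u ip_ge_0[of u] by simp
qed

lemma weight_singleton:
  assumes "e \<in> E"
  shows "weight {e} (1 / s)"
proof -
  have self: "ip (incidence e) (incidence e) = s"
    using assms card_edge by (simp add: ip_incidence)
  have "unit_vec {e} (fun_scale (1 / s) (incidence e))"
    using self s_pos unfolding unit_vec_def
    by (intro conjI fun_vs.span_scale fun_vs.span_base) (auto simp: ip_simps)
  moreover have "ip (fun_scale (1 / s) (incidence e)) (fun_scale (1 / s) (incidence e)) = 1 / s"
    using self s_pos by (simp add: ip_simps)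
  ultimately show ?thesis unfolding weight_def by blast
qed

lemma incidence_rank_singleton:
  assumes "e \<in> E"
  shows "incidence_rank {e} = 1"
proof -
  obtain p where "p \<in> e" using edge_nonempty assms by blast
  then have "incidence e p \<noteq> 0" by (simp add: incidence_def)
  then have "incidence e \<noteq> 0" by auto
  then show ?thesis
    unfolding incidence_rank_eq_dim by (simp add: fun_vs.dim_eq_card_independent)
qed

section \<open>Rank and weight of disjoint unions and of joins\<close>

lemma ip_sp_separated:
  assumes "separated X Y" "X \<subseteq> E" "Y \<subseteq> E" "v \<in> sp X" "w \<in> sp Y"
  shows "ip v w = 0"
proof -
  have "ip w (incidence x) = ip w 0" if "x \<in> X" for x
    using assms that by (intro ip_eq_on_sp[OF assms(5)])
      (auto simp: ip_simps separated_def ip_incidence subset_iff Int_commute)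
  then have "ip v w = ip v 0"
    by (intro ip_eq_on_sp[OF assms(4)]) (simp add: ip_commute ip_simps)
  then show ?thesis by (simp add: ip_simps)
qed

lemma finite_sub: "X \<subseteq> E \<Longrightarrow> finite X"
  using finite_E finite_subset by blast

lemma separated_disjoint:
  assumes "separated X Y" "X \<subseteq> E"
  shows "X \<inter> Y = {}"
  using assms edge_nonempty by (fastforce simp: separated_def)

lemma incidence_rank_separated:
  assumes "separated X Y" "X \<subseteq> E" "Y \<subseteq> E"
  shows "incidence_rank (X \<union> Y) = incidence_rank X + incidence_rank Y"
  unfolding incidence_rank_eq_dim image_Un
proof (rule fun_vs.dim_Un_if_span_Int_trivial)
  show "sp X \<inter> sp Y \<subseteq> {0}"
    using ip_sp_separated[OF assms] sp_ip_self_eq_0[OF _ assms(2)] by auto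
qed (use finite_sub assms in auto)

lemma weight_separated:
  assumes "separated X Y" "X \<subseteq> E" "Y \<subseteq> E" "weight X a" "weight Y b"
  shows "weight (X \<union> Y) (a + b)"
proof -
  obtain u where u: "unit_vec X u" "ip u u = a" using assms by (auto simp: weight_def)
  obtain v where v: "unit_vec Y v" "ip v v = b" using assms by (auto simp: weight_def)
  have sp: "u \<in> sp X" "v \<in> sp Y" using u v by (auto simp: unit_vec_def)
  have cross: "ip x y = 0" "ip y x = 0" if "x \<in> sp X" "y \<in> sp Y" for x y
    using ip_sp_separated[OF assms(1-3)] that by (auto simp: ip_commute)
  have "u + v \<in> sp (X \<union> Y)"
    using sp unfolding image_Un fun_vs.span_Un by blast
  moreover have "ip (incidence z) (u + v) = 1" if "z \<in> X \<union> Y" for z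
    using that
  proof
    assume z: "z \<in> X"
    then have "ip (incidence z) v = 0"
      using sp by (intro cross) (auto intro: fun_vs.span_base)
    with z u(1) show ?thesis by (auto simp: unit_vec_def ip_simps)
  next
    assume z: "z \<in> Y"
    then have "ip (incidence z) u = 0"
      using sp by (intro cross) (auto intro: fun_vs.span_base)
    with z v(1) show ?thesis by (auto simp: unit_vec_def ip_simps)
  qed
  ultimately have "unit_vec (X \<union> Y) (u + v)" by (simp add: unit_vec_def)
  moreover have "ip (u + v) (u + v) = a + b"
    using u v cross[OF sp] by (simp add: ip_simps)
  ultimately show ?thesis unfolding weight_def by blast
qed

text \<open>The block of the Gram matrix between \<open>X\<close> and \<open>Y\<close> has all
  entries \<open>1\<close>, hence rank one. The bilinear form between the two spans is therefore the
  product of the two coefficient-sum functionals, which \<open>u\<close> and \<open>w\<close>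
  represent.\<close>

lemma ip_sp_joined:
  assumes "joined X Y" "X \<subseteq> E" "Y \<subseteq> E" "unit_vec X u" "unit_vec Y w" "x \<in> sp X" "y \<in> sp Y"
  shows "ip x y = ip x u * ip y w"
proof -
  have "ip y (incidence z) = ip y w" if "z \<in> X" for z
    using assms(5) that ip_incidence_joined[OF assms(1-3), of z]
    by (intro ip_eq_on_sp[OF assms(7)]) (auto simp: unit_vec_def ip_commute[of _ "incidence z"])
  then have "ip (incidence z) y = ip (incidence z) (fun_scale (ip y w) u)" if "z \<in> X" for z
    using that assms(4) by (auto simp: unit_vec_def ip_simps ip_commute)
  then have "ip x y = ip x (fun_scale (ip y w) u)"
    by (rule ip_eq_on_sp[OF assms(6)])
  then show ?thesis by (simp add: ip_simps)
qed

text \<open>By \<open>ip_sp_joined\<close>, a vector of \<open>sp X\<close> has the same inner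
  product with every row of \<open>Y\<close>. If it also lies in \<open>sp Y\<close>, it must be a
  multiple of \<open>w\<close>; so the two spans share at most a line.\<close>

lemma sp_Int_joined:
  assumes "joined X Y" "X \<subseteq> E" "Y \<subseteq> E" "unit_vec X u" "unit_vec Y w" "v \<in> sp X" "v \<in> sp Y"
  shows "v = fun_scale (ip v u) w"
proof (rule sp_eqI[OF assms(7) _ assms(3)])
  show "fun_scale (ip v u) w \<in> sp Y"
    using assms(5) by (auto simp: unit_vec_def intro: fun_vs.span_scale)
  fix y assume y: "y \<in> Y"
  then have "ip v (incidence y) = ip v u * ip (incidence y) w"
    by (intro ip_sp_joined[OF assms(1-6)]) (auto intro: fun_vs.span_base)
  then show "ip (incidence y) v = ip (incidence y) (fun_scale (ip v u) w)"
    by (simp add: ip_simps ip_commute)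
qed

text \<open>Cauchy-Schwarz for \<open>u\<close> and \<open>w\<close>, whose inner product is
  \<open>a * b\<close> and whose squared norms are \<open>a\<close> and \<open>b\<close>.\<close>

lemma weight_joined_le_1:
  assumes "joined X Y" "X \<subseteq> E" "Y \<subseteq> E" "Y \<noteq> {}" "weight X a" "weight Y b"
  shows "a * b \<le> 1"
proof -
  obtain u where u: "unit_vec X u" "ip u u = a" using assms by (auto simp: weight_def)
  obtain w where w: "unit_vec Y w" "ip w w = b" using assms by (auto simp: weight_def)
  have sp: "u \<in> sp X" "w \<in> sp Y" using u w by (auto simp: unit_vec_def)
  have uw: "ip u w = a * b"
    using ip_sp_joined[OF assms(1-3) u(1) w(1) sp] u w by simp
  have "0 \<le> ip (fun_scale b u - w) (fun_scale b u - w)" by (rule ip_ge_0)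
  also have "\<dots> = b * (1 - a * b)"
    using u w uw by (simp add: ip_simps ip_commute[of w u] algebra_simps)
  finally show ?thesis
    using weight_pos[OF assms(6,4,3)] by (simp add: zero_le_mult_iff)
qed

text \<open>A common vector is a multiple of \<open>w\<close> as well as of \<open>u\<close>.
  Passing from one representation to the other and back multiplies its coefficient by
  \<open>a * b\<close>, which is not \<open>1\<close>.\<close>

lemma incidence_rank_joined_less:
  assumes "joined X Y" "X \<subseteq> E" "Y \<subseteq> E" "weight X a" "weight Y b" "a * b < 1"
  shows "incidence_rank (X \<union> Y) = incidence_rank X + incidence_rank Y"
  unfolding incidence_rank_eq_dim image_Un
proof (rule fun_vs.dim_Un_if_span_Int_trivial)
  obtain u where u: "unit_vec X u" "ip u u = a" using assms by (auto simp: weight_def)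
  obtain w where w: "unit_vec Y w" "ip w w = b" using assms by (auto simp: weight_def)
  show "sp X \<inter> sp Y \<subseteq> {0}"
  proof
    fix v assume "v \<in> sp X \<inter> sp Y"
    then have v: "v \<in> sp X" "v \<in> sp Y" by auto
    have 1: "v = fun_scale (ip v u) w"
      using sp_Int_joined[OF assms(1-3) u(1) w(1) v] .
    have 2: "v = fun_scale (ip v w) u"
      using sp_Int_joined[OF joined_sym[OF assms(1)] assms(3,2) w(1) u(1) v(2,1)] .
    have "ip v w = ip v u * b" using 1 w(2) by (metis ip_scale_left)
    moreover have "ip v u = ip v w * a" using 2 u(2) by (metis ip_scale_left)
    ultimately have "ip v u * (1 - a * b) = 0" by (simp add: algebra_simps)
    then have "ip v u = 0" using assms(6) by simp
    with 1 show "v \<in> {0}" by (simp add: fun_scale_def fun_eq_iff)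
  qed
qed (use finite_sub assms in auto)

text \<open>The case of equality in Cauchy-Schwarz.\<close>

lemma unit_vec_joined_eq_1:
  assumes "joined X Y" "X \<subseteq> E" "Y \<subseteq> E" "unit_vec X u" "unit_vec Y w" "ip u u * ip w w = 1"
  shows "u = fun_scale (ip u u) w"
proof -
  have sp: "u \<in> sp X" "w \<in> sp Y" using assms by (auto simp: unit_vec_def)
  let ?d = "u - fun_scale (ip u u) w"
  have uw: "ip u w = 1"
    using ip_sp_joined[OF assms(1-3) assms(4,5) sp] assms by simp
  have "?d \<in> sp (X \<union> Y)"
    using sp unfolding image_Un
    by (intro fun_vs.span_diff fun_vs.span_scale) (meson fun_vs.span_mono subset_iff Un_upper1 Un_upper2)+
  moreover have "ip ?d ?d = 0"
    using uw assms(6) by (simp add: ip_simps ip_commute[of w u] algebra_simps)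
  ultimately have "?d = 0"
    using assms(2,3) by (intro sp_ip_self_eq_0[of ?d "X \<union> Y"]) auto
  then show ?thesis by simp
qed

lemma incidence_rank_joined_eq:
  assumes "joined X Y" "X \<subseteq> E" "Y \<subseteq> E" "X \<noteq> {}" "weight X a" "weight Y b" "a * b = 1"
  shows "incidence_rank (X \<union> Y) + 1 = incidence_rank X + incidence_rank Y"
  unfolding incidence_rank_eq_dim image_Un
proof -
  obtain u where u: "unit_vec X u" "ip u u = a" using assms by (auto simp: weight_def)
  obtain w where w: "unit_vec Y w" "ip w w = b" using assms by (auto simp: weight_def)
  have sp: "u \<in> sp X" "w \<in> sp Y" using u w by (auto simp: unit_vec_def)
  have uw: "u = fun_scale a w"
    using unit_vec_joined_eq_1[OF assms(1-3) u(1) w(1)] u w assms(7) by simp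
  show "fun_vs.dim (incidence ` X \<union> incidence ` Y) + 1
      = fun_vs.dim (incidence ` X) + fun_vs.dim (incidence ` Y)"
  proof (rule fun_vs.dim_Un_if_span_Int_line)
    show "u \<noteq> 0" using unit_vec_nonzero u assms by blast
    show "u \<in> sp X" by fact
    have "fun_scale a w \<in> sp Y" using sp by (intro fun_vs.span_scale)
    with uw show "u \<in> sp Y" by metis
    show "sp X \<inter> sp Y \<subseteq> fun_vs.span {u}"
    proof
      fix v assume "v \<in> sp X \<inter> sp Y"
      then have "v = fun_scale (ip v w) u"
        using sp_Int_joined[OF joined_sym[OF assms(1)] assms(3,2) w(1) u(1)] by blast
      then show "v \<in> fun_vs.span {u}"
        by (metis fun_vs.span_base fun_vs.span_scale singletonI)
    qed
  qed (use finite_sub assms in auto)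
qed

lemma weight_joined_less:
  assumes "joined X Y" "X \<subseteq> E" "Y \<subseteq> E" "weight X a" "weight Y b" "a * b < 1"
  shows "weight (X \<union> Y) ((a + b - 2 * a * b) / (1 - a * b))"
proof -
  obtain u where u: "unit_vec X u" "ip u u = a" using assms by (auto simp: weight_def)
  obtain w where w: "unit_vec Y w" "ip w w = b" using assms by (auto simp: weight_def)
  have sp: "u \<in> sp X" "w \<in> sp Y" using u w by (auto simp: unit_vec_def)
  \<comment> \<open>The combination of \<open>u\<close> and \<open>w\<close> must have inner product
    \<open>1\<close> with the rows of \<open>X\<close> and with those of \<open>Y\<close>. This is a
    system of two linear equations with determinant \<open>1 - a * b\<close>, and
    \<open>\<alpha>\<close>, \<open>\<beta>\<close> are its solution by Cramer's rule.\<close>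
  define \<alpha> where "\<alpha> = (1 - b) / (1 - a * b)"
  define \<beta> where "\<beta> = (1 - a) / (1 - a * b)"
  define v where "v = fun_scale \<alpha> u + fun_scale \<beta> w"
  have ab: "\<alpha> + \<beta> * b = 1" "\<alpha> * a + \<beta> = 1"
    using assms(6) by (auto simp: \<alpha>_def \<beta>_def divide_simps) (auto simp: algebra_simps)
  have xw: "ip (incidence x) w = b" if "x \<in> X" for x
    using ip_sp_joined[OF assms(1-3) u(1) w(1) fun_vs.span_base sp(2), of "incidence x"] that u(1) w(2)
    by (auto simp: unit_vec_def)
  have yu: "ip (incidence y) u = a" if "y \<in> Y" for y
    using ip_sp_joined[OF joined_sym[OF assms(1)] assms(3,2) w(1) u(1) fun_vs.span_base sp(1),
        of "incidence y"] that w(1) u(2)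
    by (auto simp: unit_vec_def)
  have uw: "ip u w = a * b"
    using ip_sp_joined[OF assms(1-3) u(1) w(1) sp] u w by simp
  have "v \<in> sp (X \<union> Y)"
    using sp unfolding v_def image_Un
    by (intro fun_vs.span_add fun_vs.span_scale) (meson fun_vs.span_mono subset_iff Un_upper1 Un_upper2)+
  moreover have "ip (incidence z) v = 1" if "z \<in> X \<union> Y" for z
    using that u(1) w(1) xw yu ab by (auto simp: unit_vec_def v_def ip_simps)
  ultimately have "unit_vec (X \<union> Y) v" by (simp add: unit_vec_def)
  moreover have "ip v v = (a + b - 2 * a * b) / (1 - a * b)"
  proof -
    have "ip v v = \<alpha> * (a * (\<alpha> + \<beta> * b)) + \<beta> * (b * (\<alpha> * a + \<beta>))"
      using u(2) w(2) uw by (simp add: v_def ip_simps ip_commute[of w u] algebra_simps)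
    also have "\<dots> = \<alpha> * a + \<beta> * b" using ab by simp
    also have "\<dots> = (a + b - 2 * a * b) / (1 - a * b)"
      using assms(6) by (simp add: \<alpha>_def \<beta>_def divide_simps) (simp add: algebra_simps)
    finally show ?thesis .
  qed
  ultimately show ?thesis unfolding weight_def by blast
qed

text \<open>Equality in Cauchy-Schwarz makes the two unit vectors coincide, and the common vector
  also serves the union.\<close>

lemma weight_joined_1:
  assumes "joined X Y" "X \<subseteq> E" "Y \<subseteq> E" "weight X 1" "weight Y 1"
  shows "weight (X \<union> Y) 1"
proof -
  obtain u where u: "unit_vec X u" "ip u u = 1" using assms by (auto simp: weight_def)
  obtain w where w: "unit_vec Y w" "ip w w = 1" using assms by (auto simp: weight_def)
  have "u = w"
    using unit_vec_joined_eq_1[OF assms(1-3) u(1) w(1)] u w by simp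
  moreover have "u \<in> sp (X \<union> Y)"
    using u(1) unfolding unit_vec_def image_Un by (meson fun_vs.span_mono subset_iff Un_upper1)
  ultimately have "unit_vec (X \<union> Y) u"
    using u(1) w(1) by (auto simp: unit_vec_def)
  then show ?thesis using u unfolding weight_def by blast
qed

text \<open>Without a line through all of \<open>X\<close> and \<open>Y\<close> one may have \<open>a > 1 > b\<close>.\<close>

lemma weight_joined_eq_1_cases:
  assumes "joined X Y" "X \<subseteq> E" "Y \<subseteq> E" "weight X a" "weight Y b" "a * b = 1"
    and "e \<in> E" "joined {e} (X \<union> Y)"
  shows "a = 1" "b = 1"
proof -
  obtain u where u: "unit_vec X u" "ip u u = a" using assms by (auto simp: weight_def)
  obtain w where w: "unit_vec Y w" "ip w w = b" using assms by (auto simp: weight_def)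
  have sp: "u \<in> sp X" "w \<in> sp Y" using u w by (auto simp: unit_vec_def)
  have uw: "u = fun_scale a w"
    using unit_vec_joined_eq_1[OF assms(1-3) u(1) w(1)] u w assms(6) by simp
  have e1: "ip (incidence e) (incidence z) = 1" if "z \<in> X \<union> Y" for z
    by (rule ip_incidence_joined[OF assms(8)]) (use assms that in auto)
  \<comment> \<open>On \<open>sp X\<close> the edge \<open>e\<close> and the vector \<open>u\<close>
    induce the same functional, and likewise \<open>e\<close> and \<open>w\<close> on
    \<open>sp Y\<close>. Pairing \<open>e\<close> with \<open>u = a w\<close> then gives
    \<open>a = a * b\<close>.\<close>
  have "ip u (incidence e) = a"
    using ip_eq_on_sp[OF sp(1), of "incidence e" u] u e1
    by (auto simp: unit_vec_def ip_commute)
  moreover have "ip w (incidence e) = b"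
    using ip_eq_on_sp[OF sp(2), of "incidence e" w] w e1
    by (auto simp: unit_vec_def ip_commute)
  ultimately have "a = a * b"
    using uw by (metis ip_scale_left)
  with assms(6) show "a = 1" "b = 1" by auto
qed

end

section \<open>Cographs\<close>

text \<open>In contrast to \<open>cograph\<close>, adjacency is a predicate that is not confined to
  \<open>X\<close>, so passing to a subset or to the complement graph leaves nothing to adjust. Its
  values on the diagonal are irrelevant, as the four vertices are distinct; so \<open>meets\<close>
  may be used directly.\<close>

definition P4_free :: "('b \<Rightarrow> 'b \<Rightarrow> bool) \<Rightarrow> 'b set \<Rightarrow> bool" where
  "P4_free r X \<longleftrightarrow> \<not> (\<exists>a\<in>X. \<exists>b\<in>X. \<exists>c\<in>X. \<exists>d\<in>X. distinct [a, b, c, d] \<and>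
     r a b \<and> r b c \<and> r c d \<and> \<not> r a c \<and> \<not> r a d \<and> \<not> r b d)"

definition splits :: "('b \<Rightarrow> 'b \<Rightarrow> bool) \<Rightarrow> 'b set \<Rightarrow> bool" where
  "splits r X \<longleftrightarrow> (\<exists>A B. A \<noteq> {} \<and> B \<noteq> {} \<and> A \<inter> B = {} \<and> A \<union> B = X \<and> (\<forall>a\<in>A. \<forall>b\<in>B. \<not> r a b))"

lemma P4_free_mono: "P4_free r X \<Longrightarrow> Y \<subseteq> X \<Longrightarrow> P4_free r Y"
  unfolding P4_free_def by blast

text \<open>The complement of the path \<open>a, b, c, d\<close> is the path \<open>b, d, a, c\<close>.\<close>

lemma P4_free_complement:
  assumes "\<And>x y. r x y = r y x" "P4_free r X"
  shows "P4_free (\<lambda>x y. \<not> r x y) X"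
  unfolding P4_free_def
proof (intro notI, elim bexE conjE)
  fix a b c d
  assume X: "a \<in> X" "b \<in> X" "c \<in> X" "d \<in> X" and "distinct [a, b, c, d]"
    and "\<not> r a b" "\<not> r b c" "\<not> r c d" "\<not> \<not> r a c" "\<not> \<not> r a d" "\<not> \<not> r b d"
  then have "distinct [b, d, a, c] \<and> r b d \<and> r d a \<and> r a c \<and> \<not> r b a \<and> \<not> r b c \<and> \<not> r d c"
    using assms(1)[of d a] assms(1)[of b a] assms(1)[of d c] by auto
  with X assms(2) show False unfolding P4_free_def by blast
qed

lemma splitsI:
  assumes "A \<subseteq> X" "A \<noteq> {}" "A \<noteq> X" "\<And>a b. a \<in> A \<Longrightarrow> b \<in> X - A \<Longrightarrow> \<not> r a b"
  shows "splits r X"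
  unfolding splits_def
  by (rule exI[of _ A], rule exI[of _ "X - A"]) (use assms in auto)

text \<open>Suppose that neither graph on \<open>X\<close> splits. Then \<open>v\<close> has a
  non-neighbour \<open>w\<close>, say in the side \<open>C\<close>, and a neighbour \<open>z\<close>
  in the other side \<open>D\<close>. The set \<open>W\<close> of non-neighbours of \<open>v\<close>
  in \<open>C\<close> is nonempty, so some edge leaves it, from \<open>x\<close> in \<open>W\<close>
  to a neighbour \<open>y\<close> of \<open>v\<close> in \<open>C\<close>. Now
  \<open>z, v, y, x\<close> is an induced path.\<close>

lemma splits_step:
  assumes sym: "\<And>x y. r x y = r y x" and P4: "P4_free r X" and v: "v \<in> X"
    and "splits r (X - {v})"
  shows "splits r X \<or> splits (\<lambda>x y. \<not> r x y) X"
proof (rule ccontr)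
  assume neg: "\<not> ?thesis"
  obtain A B where AB: "A \<noteq> {}" "B \<noteq> {}" "A \<inter> B = {}" "A \<union> B = X - {v}"
    and sep: "\<forall>a\<in>A. \<forall>b\<in>B. \<not> r a b"
    using assms(4) unfolding splits_def by (elim exE conjE)
  have symsep: "\<not> r b a" if "a \<in> A" "b \<in> B" for a b
    using sep sym[of a b] that by simp
  have "\<exists>w\<in>X - {v}. \<not> r v w"
  proof (rule ccontr)
    assume "\<not> ?thesis"
    then have "splits (\<lambda>x y. \<not> r x y) X"
      using v AB by (intro splitsI[of "{v}" X "\<lambda>x y. \<not> r x y"]) auto
    with neg show False by blast
  qed
  then obtain w where w: "w \<in> X - {v}" "\<not> r v w" by blast
  have "\<exists>C D. D \<noteq> {} \<and> C \<inter> D = {} \<and> C \<union> D = X - {v} \<and> (\<forall>a\<in>C. \<forall>b\<in>D. \<not> r a b) \<and> w \<in> C"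
  proof (cases "w \<in> A")
    case True
    then show ?thesis using AB sep by blast
  next
    case False
    then have "w \<in> B" using AB w by blast
    moreover have "\<forall>b\<in>B. \<forall>a\<in>A. \<not> r b a" using symsep by simp
    moreover have "B \<inter> A = {}" "B \<union> A = X - {v}" using AB by auto
    ultimately show ?thesis using AB(1) by (intro exI[of _ B] exI[of _ A]) simp
  qed
  then obtain C D where CD: "D \<noteq> {}" "C \<inter> D = {}" "C \<union> D = X - {v}" "w \<in> C"
    and sepCD1: "\<forall>a\<in>C. \<forall>b\<in>D. \<not> r a b"
    by blast
  have sepCD: "\<not> r a b" "\<not> r b a" if "a \<in> C" "b \<in> D" for a b
    using sepCD1 sym[of b a] that by simp_all
  define W where "W = {w \<in> C. \<not> r v w}"
  have "\<exists>x\<in>W. \<exists>y\<in>X - W. r x y"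
  proof (rule ccontr)
    assume "\<not> ?thesis"
    then have "splits r X"
      using w v CD by (intro splitsI[of W X r]) (auto simp: W_def)
    with neg show False by blast
  qed
  then obtain x y where x: "x \<in> C" "\<not> r v x" and y: "y \<in> X" "y \<notin> W" "r x y"
    by (auto simp: W_def)
  have "y \<noteq> v" using x(2) y(3) sym[of x v] by auto
  then have yC: "y \<in> C" "r v y"
    using sepCD(1)[OF x(1), of y] y CD(3) by (auto simp: W_def)
  have "\<exists>z\<in>D. \<exists>u\<in>X - D. r z u"
  proof (rule ccontr)
    assume "\<not> ?thesis"
    then have "splits r X"
      using v CD by (intro splitsI[of D X r]) auto
    with neg show False by blast
  qed
  then obtain z where z: "z \<in> D" "r z v"
    using sepCD(2) CD(3) by blast
  have "z \<noteq> v" "x \<noteq> v" "y \<noteq> v" using z x yC CD(3) by blast+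
  moreover have "z \<noteq> y" "z \<noteq> x" "y \<noteq> x" using z x yC CD(2) by blast+
  moreover have "r y x" using y(3) sym[of x y] by simp
  ultimately have "distinct [z, v, y, x] \<and> r z v \<and> r v y \<and> r y x \<and> \<not> r z y \<and> \<not> r z x \<and> \<not> r v x"
    using z x yC sepCD(2) by simp
  moreover have "z \<in> X" "x \<in> X" using z x CD by auto
  ultimately show False
    using P4 v y(1) unfolding P4_free_def by blast
qed

text \<open>Seinsche's theorem. \<open>splits_step\<close> is used for the graph or for its
  complement, depending on which of them splits after removal of \<open>v\<close>; both are free of
  induced paths on four vertices by \<open>P4_free_complement\<close>.\<close>

theorem cograph_splits:
  assumes sym: "\<And>x y. r x y = r y x" and "P4_free r X" "finite X" "2 \<le> card X"
  shows "splits r X \<or> splits (\<lambda>x y. \<not> r x y) X"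
  using assms(3,2,4)
proof (induction X rule: finite_induct)
  case empty
  then show ?case by simp
next
  case (insert v X)
  show ?case
  proof (cases "2 \<le> card X")
    case True
    then have split: "splits r X \<or> splits (\<lambda>x y. \<not> r x y) X"
      using insert P4_free_mono[of r "insert v X" X] by blast
    have "insert v X - {v} = X" using insert by auto
    then show ?thesis
      using split splits_step[of r "insert v X" v]
        splits_step[of "\<lambda>x y. \<not> r x y" "insert v X" v] sym insert.prems(1)
        P4_free_complement[OF sym insert.prems(1)] by auto
  next
    case False
    then have "card X = 1" using insert by simp
    then obtain w where "X = {w}" by (auto simp: card_1_singleton_iff)
    then show ?thesis
      using insert.hyps(2) splitsI[of "{v}" "insert v X" r]
        splitsI[of "{v}" "insert v X" "\<lambda>x y. \<not> r x y"] by fastforce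
  qed
qed

section \<open>Lower bounds for the defect\<close>

abbreviation meets :: "'a set \<Rightarrow> 'a set \<Rightarrow> bool" where
  "meets e f \<equiv> e \<inter> f \<noteq> {}"

lemma splits_meets_cases:
  assumes "splits meets X \<or> splits (\<lambda>x y. \<not> meets x y) X"
  obtains A B where "A \<noteq> {}" "B \<noteq> {}" "A \<inter> B = {}" "A \<union> B = X" "separated A B \<or> joined A B"
  using assms
proof
  assume "splits meets X"
  then obtain A B where "A \<noteq> {}" "B \<noteq> {}" "A \<inter> B = {}" "A \<union> B = X" "\<forall>a\<in>A. \<forall>b\<in>B. \<not> meets a b"
    unfolding splits_def by auto
  then show thesis using that[of A B] by (auto simp: separated_def)
next
  assume "splits (\<lambda>x y. \<not> meets x y) X"
  then obtain A B where "A \<noteq> {}" "B \<noteq> {}" "A \<inter> B = {}" "A \<union> B = X" "\<forall>a\<in>A. \<forall>b\<in>B. meets a b"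
    unfolding splits_def by auto
  then show thesis using that[of A B] by (auto simp: joined_def)
qed

text \<open>Written as \<open>a + b\<close> plus a correction, \<open>t\<close> exceeds
  \<open>a + b\<close> or falls below it according to the sign of \<open>a + b - 2\<close>. This is
  the origin of the cap \<open>2\<close>: below it the weight is strictly subadditive, and from
  there on the cap hides the growth of \<open>t\<close>.\<close>

lemma joined_weight_bound:
  fixes a b :: real
  assumes "0 < a" "0 < b" "a * b < 1"
  defines "t \<equiv> (a + b - 2 * a * b) / (1 - a * b)"
  shows "min t 2 \<le> min a 2 + min b 2" "t \<le> 1 \<Longrightarrow> t < min a 2 + min b 2"
proof -
  have eq: "t = a + b + a * b * (a + b - 2) / (1 - a * b)"
    using assms(3) by (simp add: t_def divide_simps) (simp add: algebra_simps)
  show "min t 2 \<le> min a 2 + min b 2" "t \<le> 1 \<Longrightarrow> t < min a 2 + min b 2"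
  proof (atomize(full), cases "a + b < 2")
    case True
    then have "a * b * (a + b - 2) / (1 - a * b) < 0"
      using assms by (intro divide_neg_pos mult_pos_neg) auto
    then have "t < a + b" using eq by simp
    moreover have "min a 2 = a" "min b 2 = b" using True assms by auto
    ultimately show "min t 2 \<le> min a 2 + min b 2 \<and> (t \<le> 1 \<longrightarrow> t < min a 2 + min b 2)" by auto
  next
    case False
    then have "0 \<le> a * b * (a + b - 2) / (1 - a * b)"
      using assms by simp
    then have "a + b \<le> t" using eq by simp
    with False assms show "min t 2 \<le> min a 2 + min b 2 \<and> (t \<le> 1 \<longrightarrow> t < min a 2 + min b 2)" by auto
  qed
qed

context uniform_linear
begin

text \<open>A full class of \<open>X\<close> behaves like a parallel class of a net on which all of \<open>X\<close> lives.\<close>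

definition full_class :: "'a set set \<Rightarrow> 'a set set \<Rightarrow> bool" where
  "full_class K X \<longleftrightarrow> K \<subseteq> X \<and> card K = s \<and> disjoint K \<and> joined K (X - K)"

text \<open>The factor \<open>min t 2\<close>, rather than \<open>t\<close>, is what makes the bound stable under joins.\<close>

definition controlled :: "'a set set \<Rightarrow> bool" where
  "controlled X \<longleftrightarrow> (\<exists>t::real. weight X t \<and> real s * min t 2 \<le> rank_defect s X \<and>
     (incidence_rank X < card X \<longrightarrow> int s \<le> rank_defect s X) \<and>
     (t \<le> 1 \<and> rank_defect s X \<le> s * t \<longrightarrow> disjoint X \<and> incidence_rank X = card X))"

lemma rank_defect_full: "incidence_rank X = card X \<Longrightarrow> rank_defect s X = int (card X)"
  by (simp add: rank_defect_def algebra_simps)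

lemma rank_defect_Un:
  assumes "finite X" "finite Y" "X \<inter> Y = {}"
    and "incidence_rank (X \<union> Y) = incidence_rank X + incidence_rank Y"
  shows "rank_defect s (X \<union> Y) = rank_defect s X + rank_defect s Y"
  using assms by (simp add: rank_defect_def card_Un_disjoint algebra_simps)

lemma rank_defect_separated:
  assumes "separated X Y" "X \<subseteq> E" "Y \<subseteq> E"
  shows "rank_defect s (X \<union> Y) = rank_defect s X + rank_defect s Y"
  using assms by (intro rank_defect_Un finite_sub incidence_rank_separated separated_disjoint)

lemma rank_defect_joined_less:
  assumes "joined X Y" "X \<subseteq> E" "Y \<subseteq> E" "weight X a" "weight Y b" "a * b < 1"
  shows "rank_defect s (X \<union> Y) = rank_defect s X + rank_defect s Y"
  using assms
  by (intro rank_defect_Un finite_sub incidence_rank_joined_less) (auto simp: joined_def)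

lemma rank_defect_joined_eq:
  assumes "joined X Y" "X \<subseteq> E" "Y \<subseteq> E" "X \<noteq> {}" "weight X a" "weight Y b" "a * b = 1"
  shows "rank_defect s (X \<union> Y) = rank_defect s X + rank_defect s Y - (int s + 1)"
proof -
  have "incidence_rank X + incidence_rank Y = incidence_rank (X \<union> Y) + 1"
    using incidence_rank_joined_eq[OF assms] by simp
  then have "(int s + 1) * (int (incidence_rank X) + int (incidence_rank Y))
      = (int s + 1) * (int (incidence_rank (X \<union> Y)) + 1)"
    by (metis of_nat_1 of_nat_add)
  moreover have "int (card (X \<union> Y)) = int (card X) + int (card Y)"
    using assms finite_sub by (simp add: card_Un_disjoint joined_def)
  ultimately show ?thesis
    by (simp add: rank_defect_def algebra_simps)
qed

text \<open>The \<open>s\<close> disjoint members of \<open>K\<close> each contain one of the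
  \<open>s\<close> points of \<open>e\<close>, so no point is left over.\<close>

lemma edge_subset_Union_class:
  assumes "e \<in> E" "K \<subseteq> E" "disjoint K" "card K = s" "joined {e} K"
  shows "e \<subseteq> \<Union>K"
proof -
  have "card (e \<inter> k) = 1" if "k \<in> K" for k
    using assms that by (intro card_Int_edge) (auto simp: joined_def)
  moreover have "e \<inter> \<Union>K = (\<Union>k\<in>K. e \<inter> k)" by auto
  moreover have "card (\<Union>k\<in>K. e \<inter> k) = (\<Sum>k\<in>K. card (e \<inter> k))"
    using assms finite_edge finite_sub
    by (intro card_UN_disjoint) (auto simp: disjoint_def)
  ultimately have "card (e \<inter> \<Union>K) = s"
    using assms(4) by simp
  then have "e \<inter> \<Union>K = e"
    using card_edge[OF assms(1)] finite_edge[OF assms(1)]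
    by (intro card_subset_eq) auto
  then show ?thesis by blast
qed

text \<open>A full class of \<open>X\<close> would use up all points of \<open>e\<close>, leaving
  none where \<open>e\<close> could meet an edge of \<open>Y\<close>.\<close>

lemma no_full_class_separated:
  assumes "e \<in> E" "joined {e} (X \<union> Y)" "separated X Y" "X \<subseteq> E" "Y \<noteq> {}"
  shows "\<not> full_class K X"
proof
  assume K: "full_class K X"
  then have "e \<subseteq> \<Union>K"
    using assms by (intro edge_subset_Union_class) (auto simp: full_class_def joined_def)
  moreover obtain y where "y \<in> Y" "e \<inter> y \<noteq> {}"
    using assms by (auto simp: joined_def)
  ultimately show False
    using K assms(3) unfolding separated_def full_class_def by blast
qed

lemma full_class_joined:
  assumes "joined X Y" "full_class K X"
  shows "full_class K (X \<union> Y)"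
  using assms unfolding joined_def full_class_def by blast

lemma controlledE:
  assumes "controlled X" "X \<subseteq> E" "X \<noteq> {}"
  obtains t :: real where "weight X t" "0 < t" "real s * min t 2 \<le> rank_defect s X"
    "incidence_rank X < card X \<Longrightarrow> int s \<le> rank_defect s X" "0 < rank_defect s X"
    "t \<le> 1 \<Longrightarrow> rank_defect s X \<le> s * t \<Longrightarrow> disjoint X \<and> incidence_rank X = card X"
proof -
  obtain t :: real where t: "weight X t" "real s * min t 2 \<le> rank_defect s X"
    "incidence_rank X < card X \<Longrightarrow> int s \<le> rank_defect s X"
    "t \<le> 1 \<Longrightarrow> rank_defect s X \<le> s * t \<Longrightarrow> disjoint X \<and> incidence_rank X = card X"
    using assms(1) unfolding controlled_def by blast
  moreover have "0 < t" using weight_pos t(1) assms by blast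
  moreover from this have "0 < real s * min t 2" using s_pos by simp
  then have "0 < rank_defect s X" using t(2) by linarith
  ultimately show ?thesis using that by blast
qed

lemma controlled_singleton:
  assumes "e \<in> E"
  shows "controlled {e}"
proof -
  have R: "incidence_rank {e} = card {e}" "rank_defect s {e} = 1"
    using incidence_rank_singleton[OF assms] rank_defect_full[of "{e}"] by auto
  have "real s * min (1 / real s) 2 \<le> 1"
    using s_pos by (auto simp: min_def field_simps)
  then show ?thesis
    unfolding controlled_def using R weight_singleton[OF assms]
    by (intro exI[of _ "1 / real s"]) auto
qed

text \<open>Weights, ranks and defects all add. In the last clause, tightness of the summed bound
  forces tightness on either side.\<close>

lemma controlled_separated:
  assumes "separated X Y" "X \<subseteq> E" "Y \<subseteq> E" "X \<noteq> {}" "Y \<noteq> {}" "controlled X" "controlled Y"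
  shows "controlled (X \<union> Y)"
proof -
  obtain a :: real where a: "weight X a" "0 < a" "real s * min a 2 \<le> rank_defect s X"
      "incidence_rank X < card X \<Longrightarrow> int s \<le> rank_defect s X" "0 < rank_defect s X"
      "a \<le> 1 \<Longrightarrow> rank_defect s X \<le> s * a \<Longrightarrow> disjoint X \<and> incidence_rank X = card X"
    using controlledE[OF assms(6,2,4)] by metis
  obtain b :: real where b: "weight Y b" "0 < b" "real s * min b 2 \<le> rank_defect s Y"
      "incidence_rank Y < card Y \<Longrightarrow> int s \<le> rank_defect s Y" "0 < rank_defect s Y"
      "b \<le> 1 \<Longrightarrow> rank_defect s Y \<le> s * b \<Longrightarrow> disjoint Y \<and> incidence_rank Y = card Y"
    using controlledE[OF assms(7,3,5)] by metis
  have R: "rank_defect s (X \<union> Y) = rank_defect s X + rank_defect s Y"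
    using rank_defect_separated assms by blast
  have card: "card (X \<union> Y) = card X + card Y"
    using assms finite_sub separated_disjoint by (simp add: card_Un_disjoint)
  have rank: "incidence_rank (X \<union> Y) = incidence_rank X + incidence_rank Y"
    using incidence_rank_separated assms by blast
  have "s * min (a + b) 2 \<le> s * (min a 2 + min b 2)"
    using a(2) b(2) by (intro mult_left_mono) auto
  also have "\<dots> \<le> rank_defect s (X \<union> Y)"
    using a(3) b(3) R by (simp add: algebra_simps)
  finally have 1: "s * min (a + b) 2 \<le> rank_defect s (X \<union> Y)" .
  have 2: "int s \<le> rank_defect s (X \<union> Y)" if "incidence_rank (X \<union> Y) < card (X \<union> Y)"
  proof -
    have "incidence_rank X < card X \<or> incidence_rank Y < card Y"
      using that card rank by linarith
    then show ?thesis using a(4,5) b(4,5) R by linarith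
  qed
  have 3: "disjoint (X \<union> Y) \<and> incidence_rank (X \<union> Y) = card (X \<union> Y)"
    if "a + b \<le> 1" "rank_defect s (X \<union> Y) \<le> s * (a + b)"
  proof -
    have "min a 2 = a" "min b 2 = b" using that a(2) b(2) by auto
    then have "rank_defect s X \<le> s * a" "rank_defect s Y \<le> s * b"
      using a(3) b(3) that(2) R by (auto simp: algebra_simps)
    then have "disjoint X" "disjoint Y" "incidence_rank X = card X" "incidence_rank Y = card Y"
      using a(2,6) b(2,6) that by auto
    moreover from this have "disjoint (X \<union> Y)"
      using assms(1) unfolding separated_def disjoint_def by blast
    ultimately show ?thesis using card rank by simp
  qed
  show ?thesis
    unfolding controlled_def using weight_separated[OF assms(1-3) a(1) b(1)] 1 2 3 by blast
qed

text \<open>A family of weight \<open>1\<close> with defect exactly \<open>s\<close> would consist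
  of \<open>s\<close> disjoint edges and so be a full class of itself. This one extra unit pays for
  the dimension lost in a critical join.\<close>

lemma defect_if_weight_1:
  assumes "X \<subseteq> E" "\<not> full_class X X" "real s \<le> rank_defect s X"
    "rank_defect s X \<le> s \<Longrightarrow> disjoint X \<and> incidence_rank X = card X"
  shows "int s + 1 \<le> rank_defect s X"
proof (rule ccontr)
  assume "\<not> ?thesis"
  then have R: "rank_defect s X = int s" using assms(3) by linarith
  then have "disjoint X" "incidence_rank X = card X" using assms(4) by auto
  moreover from this have "card X = s" using rank_defect_full[of X] R by simp
  ultimately show False using assms(2) by (simp add: full_class_def joined_def)
qed

text \<open>For \<open>a * b < 1\<close> the last clause of \<open>controlled\<close> is vacuous,
  since a weight at most \<open>1\<close> is strictly below the sum of the capped weights. For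
  \<open>a * b = 1\<close> both weights are \<open>1\<close> thanks to \<open>e\<close>; each side
  then has defect at least \<open>s + 1\<close>, so at least \<open>s + 1\<close> remains after the
  loss.\<close>

lemma controlled_joined:
  assumes "joined X Y" "X \<subseteq> E" "Y \<subseteq> E" "X \<noteq> {}" "Y \<noteq> {}" "controlled X" "controlled Y"
    and "\<not> full_class X X" "\<not> full_class Y Y" "e \<in> E" "joined {e} (X \<union> Y)"
  shows "controlled (X \<union> Y)"
proof -
  obtain a :: real where a: "weight X a" "0 < a" "real s * min a 2 \<le> rank_defect s X"
      "incidence_rank X < card X \<Longrightarrow> int s \<le> rank_defect s X" "0 < rank_defect s X"
      "a \<le> 1 \<Longrightarrow> rank_defect s X \<le> s * a \<Longrightarrow> disjoint X \<and> incidence_rank X = card X"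
    using controlledE[OF assms(6,2,4)] by metis
  obtain b :: real where b: "weight Y b" "0 < b" "real s * min b 2 \<le> rank_defect s Y"
      "incidence_rank Y < card Y \<Longrightarrow> int s \<le> rank_defect s Y" "0 < rank_defect s Y"
      "b \<le> 1 \<Longrightarrow> rank_defect s Y \<le> s * b \<Longrightarrow> disjoint Y \<and> incidence_rank Y = card Y"
    using controlledE[OF assms(7,3,5)] by metis
  have card: "card (X \<union> Y) = card X + card Y"
    using assms finite_sub by (simp add: card_Un_disjoint joined_def)
  have "a * b \<le> 1" using weight_joined_le_1[OF assms(1-3,5) a(1) b(1)] .
  then consider "a * b < 1" | "a * b = 1" by linarith
  then show ?thesis
  proof cases
    case 1
    define t where "t = (a + b - 2 * a * b) / (1 - a * b)"
    have t: "weight (X \<union> Y) t"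
      using weight_joined_less[OF assms(1-3) a(1) b(1) 1] by (simp add: t_def)
    have R: "rank_defect s (X \<union> Y) = rank_defect s X + rank_defect s Y"
      using rank_defect_joined_less[OF assms(1-3) a(1) b(1) 1] .
    have rank: "incidence_rank (X \<union> Y) = incidence_rank X + incidence_rank Y"
      using incidence_rank_joined_less[OF assms(1-3) a(1) b(1) 1] .
    have sum: "real s * (min a 2 + min b 2) \<le> rank_defect s (X \<union> Y)"
      using a(3) b(3) R by (simp add: algebra_simps)
    have "real s * min t 2 \<le> real s * (min a 2 + min b 2)"
      using joined_weight_bound(1)[OF a(2) b(2) 1] by (intro mult_left_mono) (auto simp: t_def)
    with sum have 2: "real s * min t 2 \<le> rank_defect s (X \<union> Y)" by linarith
    have 3: "int s \<le> rank_defect s (X \<union> Y)" if "incidence_rank (X \<union> Y) < card (X \<union> Y)"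
    proof -
      have "incidence_rank X < card X \<or> incidence_rank Y < card Y"
        using that card rank by linarith
      then show ?thesis using a(4,5) b(4,5) R by linarith
    qed
    have 4: "\<not> (t \<le> 1 \<and> rank_defect s (X \<union> Y) \<le> s * t)"
    proof
      assume *: "t \<le> 1 \<and> rank_defect s (X \<union> Y) \<le> s * t"
      then have "t < min a 2 + min b 2"
        using joined_weight_bound(2)[OF a(2) b(2) 1] by (simp add: t_def)
      then have "real s * t < real s * (min a 2 + min b 2)" using s_pos by simp
      with sum * show False by linarith
    qed
    show ?thesis unfolding controlled_def using t 2 3 4 by blast
  next
    case 2
    have ab: "a = 1" "b = 1"
      using weight_joined_eq_1_cases[OF assms(1-3) a(1) b(1) 2 assms(10,11)] by auto
    have "int s + 1 \<le> rank_defect s X" "int s + 1 \<le> rank_defect s Y"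
      using defect_if_weight_1[OF assms(2,8)] defect_if_weight_1[OF assms(3,9)] a(3,6) b(3,6) ab
      by simp_all
    moreover have "rank_defect s (X \<union> Y) = rank_defect s X + rank_defect s Y - (int s + 1)"
      using rank_defect_joined_eq[OF assms(1-4) a(1) b(1) 2] .
    ultimately have R: "int s + 1 \<le> rank_defect s (X \<union> Y)" by linarith
    have "weight (X \<union> Y) 1"
      using weight_joined_1[OF assms(1-3)] a(1) b(1) ab by simp
    then show ?thesis
      unfolding controlled_def using R by (intro exI[of _ 1]) auto
  qed
qed

text \<open>Induction along the decomposition of the cograph. The absence of full classes has to be
  inherited by both sides: at a join, a full class of a side would be full in the whole; at a
  disjoint union, the edge \<open>e\<close> excludes it. The edge \<open>e\<close> lies outside
  \<open>X\<close> and stays the same throughout.\<close>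

theorem controlled_if_no_full_class:
  assumes "X \<subseteq> E" "X \<noteq> {}" "P4_free meets X" "\<And>K. \<not> full_class K X" "e \<in> E" "joined {e} X"
  shows "controlled X"
  using assms
proof (induction "card X" arbitrary: X rule: less_induct)
  case less
  show ?case
  proof (cases "2 \<le> card X")
    case False
    moreover have "card X \<noteq> 0" using less.prems finite_sub by auto
    ultimately have "card X = 1" by linarith
    then obtain x where "X = {x}" by (auto simp: card_1_singleton_iff)
    then show ?thesis using controlled_singleton less.prems(1) by auto
  next
    case True
    have fin: "finite X" using less.prems finite_sub by blast
    have "splits meets X \<or> splits (\<lambda>x y. \<not> meets x y) X"
      by (rule cograph_splits) (use less.prems(3) fin True in \<open>auto simp: Int_commute\<close>)
    then obtain A B where AB: "A \<noteq> {}" "B \<noteq> {}" "A \<inter> B = {}" "A \<union> B = X"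
      and cases: "separated A B \<or> joined A B"
      by (rule splits_meets_cases)
    have small: "card A < card X" "card B < card X"
    proof -
      have "A \<subset> X" "B \<subset> X" using AB by blast+
      then show "card A < card X" "card B < card X" using fin by (simp_all add: psubset_card_mono)
    qed
    have sub: "A \<subseteq> E" "B \<subseteq> E" using AB less.prems by auto
    have P4: "P4_free meets A" "P4_free meets B"
      using less.prems(3) AB P4_free_mono by blast+
    have e: "joined {e} A" "joined {e} B"
      using less.prems(6) AB joined_mono by blast+
    consider "separated A B" | "joined A B" using cases by blast
    then show ?thesis
    proof cases
      case 1
      have "joined {e} (A \<union> B)" "joined {e} (B \<union> A)" "separated B A"
        using less.prems(6) AB(4) separated_sym[OF 1] by (auto simp: Un_commute)
      then have no: "\<not> full_class K A" "\<not> full_class K B" for K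
        using no_full_class_separated[of e A B K] no_full_class_separated[of e B A K]
          1 AB sub less.prems(5) by auto
      have "controlled A" "controlled B"
        using less.hyps[OF small(1)] less.hyps[OF small(2)] sub AB P4 e less.prems(5) no by auto
      then show ?thesis
        using controlled_separated[OF 1 sub AB(1,2)] AB(4) by simp
    next
      case 2
      have no: "\<not> full_class K A" "\<not> full_class K B" for K
        using full_class_joined[OF 2, of K] full_class_joined[OF joined_sym[OF 2], of K]
          less.prems(4) AB(4) by (auto simp: Un_commute)
      have "controlled A" "controlled B"
        using less.hyps[OF small(1)] less.hyps[OF small(2)] sub AB P4 e less.prems(5) no by auto
      then show ?thesis
        using controlled_joined[OF 2 sub AB(1,2) _ _ no less.prems(5)] AB(4) less.prems(6) by simp
    qed
  qed
qed

text \<open>The outermost join: each side is controlled by means of an edge of the other side, but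
  no edge is given that meets both, so \<open>a * b = 1\<close> with \<open>a \<noteq> 1\<close>
  remains possible. In that case it suffices that the two defects sum to at least
  \<open>2 s + 1\<close>.\<close>

theorem defect_if_no_full_class:
  assumes "X \<subseteq> E" "P4_free meets X" "\<And>K. \<not> full_class K X"
    and AB: "A \<noteq> {}" "B \<noteq> {}" "A \<union> B = X" and j: "joined A B"
    and "incidence_rank X < card X"
  shows "int s \<le> rank_defect s X"
proof -
  have sub: "A \<subseteq> E" "B \<subseteq> E" using AB assms by auto
  obtain x y where xy: "x \<in> A" "y \<in> B" using AB by blast
  have no: "\<not> full_class K A" "\<not> full_class K B" for K
    using full_class_joined[OF j, of K] full_class_joined[OF joined_sym[OF j], of K]
      assms(3) AB(3) by (auto simp: Un_commute)
  have "joined {y} A" "joined {x} B"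
    using j joined_sym[OF j] xy joined_mono by blast+
  moreover have "P4_free meets A" "P4_free meets B"
    using assms(2) AB P4_free_mono by blast+
  ultimately have cA: "controlled A" and cB: "controlled B"
    using controlled_if_no_full_class[of A y] controlled_if_no_full_class[of B x] sub AB no xy by auto
  obtain a :: real where a: "weight A a" "0 < a" "real s * min a 2 \<le> rank_defect s A"
      "incidence_rank A < card A \<Longrightarrow> int s \<le> rank_defect s A" "0 < rank_defect s A"
      "a \<le> 1 \<Longrightarrow> rank_defect s A \<le> s * a \<Longrightarrow> disjoint A \<and> incidence_rank A = card A"
    using controlledE[OF cA sub(1) AB(1)] by metis
  obtain b :: real where b: "weight B b" "0 < b" "real s * min b 2 \<le> rank_defect s B"
      "incidence_rank B < card B \<Longrightarrow> int s \<le> rank_defect s B" "0 < rank_defect s B"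
      "b \<le> 1 \<Longrightarrow> rank_defect s B \<le> s * b \<Longrightarrow> disjoint B \<and> incidence_rank B = card B"
    using controlledE[OF cB sub(2) AB(2)] by metis
  have "a * b \<le> 1" using weight_joined_le_1[OF j sub AB(2) a(1) b(1)] .
  then consider "a * b < 1" | "a * b = 1" by linarith
  then show ?thesis
  proof cases
    case 1
    have "rank_defect s X = rank_defect s A + rank_defect s B"
      using rank_defect_joined_less[OF j sub a(1) b(1) 1] AB by simp
    moreover have "incidence_rank X = incidence_rank A + incidence_rank B"
      using incidence_rank_joined_less[OF j sub a(1) b(1) 1] AB by simp
    moreover have "card X = card A + card B"
      using card_Un_disjoint[OF finite_sub[OF sub(1)] finite_sub[OF sub(2)]] j AB(3)
      by (simp add: joined_def)
    ultimately show ?thesis using assms(8) a(4,5) b(4,5) by linarith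
  next
    case 2
    have R: "rank_defect s X = rank_defect s A + rank_defect s B - (int s + 1)"
      using rank_defect_joined_eq[OF j sub AB(1) a(1) b(1) 2] AB by simp
    show ?thesis
    proof (cases "a = 1")
      case True
      then have "b = 1" using 2 by simp
      then have "int s + 1 \<le> rank_defect s A" "int s + 1 \<le> rank_defect s B"
        using True defect_if_weight_1[OF sub(1) no(1)] defect_if_weight_1[OF sub(2) no(2)] a(3,6) b(3,6)
        by simp_all
      then show ?thesis using R by linarith
    next
      case False
      have "2 * int s + 1 \<le> rank_defect s A + rank_defect s B"
      proof (cases "2 \<le> a \<or> 2 \<le> b")
        case True
        then have "min a 2 = 2 \<or> min b 2 = 2" by auto
        then have "2 * real s \<le> rank_defect s A \<or> 2 * real s \<le> rank_defect s B"
          using a(3) b(3) by (elim disjE) (simp_all add: mult.commute)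
        then have "2 * int s \<le> rank_defect s A \<or> 2 * int s \<le> rank_defect s B"
          by linarith
        then show ?thesis using a(5) b(5) by linarith
      next
        case less: False
        \<comment> \<open>From \<open>a * b = 1\<close> and \<open>a \<noteq> 1\<close> follows
          \<open>a + b > 2\<close>. As neither weight is capped here, the defects sum to more than
          \<open>2 s\<close>, and integrality gives the missing unit.\<close>
        have "0 < (a - 1)\<^sup>2" using False by simp
        moreover have "(a - 1)\<^sup>2 = a * a + a * b - 2 * a"
          unfolding 2 by (simp add: power2_eq_square algebra_simps)
        ultimately have "2 * a < (a + b) * a" by (simp add: algebra_simps)
        then have "2 < a + b" using a(2) by simp
        then have "real s * 2 < real s * (a + b)" using s_pos by simp
        then have "2 * real s < real s * a + real s * b" by (simp add: algebra_simps)
        also have "\<dots> \<le> real_of_int (rank_defect s A + rank_defect s B)"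
          using a(3) b(3) less by simp
        finally show ?thesis by linarith
      qed
      then show ?thesis using R by linarith
    qed
  qed
qed

end

section \<open>Parallel classes\<close>

context uniform_linear
begin

text \<open>Every edge contributes \<open>1 / s\<close>, so the critical weight \<open>1\<close> is
  reached with exactly \<open>s\<close> disjoint edges.\<close>

lemma weight_disjoint:
  assumes "K \<subseteq> E" "K \<noteq> {}" "disjoint K"
  shows "weight K (card K / s) \<and> incidence_rank K = card K"
proof -
  have "finite K" using assms finite_sub by blast
  then show ?thesis
    using assms(2,1,3)
  proof (induction K rule: finite_ne_induct)
    case (singleton x)
    then show ?case using weight_singleton incidence_rank_singleton by simp
  next
    case (insert x F)
    have sep: "separated {x} F"
      using insert.prems(2) insert.hyps(3) by (auto simp: separated_def disjoint_def)
    have F: "F \<subseteq> E" "{x} \<subseteq> E" using insert.prems by auto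
    have IH: "weight F (card F / s)" "incidence_rank F = card F"
      using insert.IH insert.prems by (auto simp: disjoint_def)
    have "weight (insert x F) (1 / s + card F / s)"
      using weight_separated[OF sep F(2,1) weight_singleton IH(1)] F by simp
    moreover have "incidence_rank (insert x F) = card (insert x F)"
      using incidence_rank_separated[OF sep F(2,1)] incidence_rank_singleton[of x] IH(2) F insert.hyps
      by simp
    moreover have "1 / real s + card F / s = card (insert x F) / s"
      using insert.hyps by (simp add: add_divide_distrib)
    ultimately show ?case by simp
  qed
qed

text \<open>The first class has defect \<open>s\<close>. Each further one is joined at weight
  \<open>1\<close> and changes the defect by \<open>s - (s + 1) = - 1\<close>.\<close>

lemma weight_full_classes:
  assumes "finite D" "D \<noteq> {}" "\<And>K. K \<in> D \<Longrightarrow> K \<subseteq> E \<and> card K = s \<and> disjoint K"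
    and "\<And>K L. K \<in> D \<Longrightarrow> L \<in> D \<Longrightarrow> K \<noteq> L \<Longrightarrow> joined K L"
  shows "weight (\<Union>D) 1 \<and> rank_defect s (\<Union>D) = int s + 1 - int (card D)"
  using assms
proof (induction D rule: finite_ne_induct)
  case (singleton K)
  then have K: "K \<subseteq> E" "card K = s" "disjoint K" by auto
  then have "K \<noteq> {}" using s_pos by auto
  with K show ?case
    using weight_disjoint[of K] rank_defect_full[of K] s_pos by auto
next
  case (insert K D)
  then have K: "K \<subseteq> E" "card K = s" "disjoint K" by auto
  then have "K \<noteq> {}" using s_pos by auto
  with K have w: "weight K 1" and R: "rank_defect s K = s"
    using weight_disjoint[of K] rank_defect_full[of K] s_pos by auto
  have IH: "weight (\<Union>D) 1" "rank_defect s (\<Union>D) = int s + 1 - int (card D)"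
    using insert.IH insert.prems by auto
  have "joined K L" if "L \<in> D" for L
    using insert.prems(2)[of K L] insert.hyps that by auto
  then have j: "joined K (\<Union>D)" unfolding joined_def by blast
  have D: "\<Union>D \<subseteq> E" using insert.prems by blast
  show ?case
    using weight_joined_1[OF j K(1) D w IH(1)] IH(2) R insert.hyps
      rank_defect_joined_eq[OF j K(1) D \<open>K \<noteq> {}\<close> w IH(1)] by simp
qed

text \<open>Weight \<open>1\<close> is a fixed point of the join formula, so after adding an
  incomplete class the remaining family again has weight \<open>1\<close>. No such join is critical,
  hence every added edge raises the defect by exactly one.\<close>

lemma rank_defect_partial_classes:
  assumes "finite F" "Y \<subseteq> E" "weight Y 1"
    and "\<And>K. K \<in> F \<Longrightarrow> K \<subseteq> E \<and> card K < s \<and> disjoint K \<and> joined K Y"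
    and "\<And>K L. K \<in> F \<Longrightarrow> L \<in> F \<Longrightarrow> K \<noteq> L \<Longrightarrow> joined K L"
  shows "weight (\<Union>F \<union> Y) 1 \<and> rank_defect s (\<Union>F \<union> Y) = rank_defect s Y + int (card (\<Union>F))"
  using assms(1,4,5)
proof (induction F rule: finite_induct)
  case empty
  then show ?case using assms(3) by simp
next
  case (insert K F)
  then have K: "K \<subseteq> E" "card K < s" "disjoint K" "joined K Y" by auto
  have IH: "weight (\<Union>F \<union> Y) 1" "rank_defect s (\<Union>F \<union> Y) = rank_defect s Y + int (card (\<Union>F))"
    using insert.IH insert.prems by auto
  have "joined K L" if "L \<in> F" for L
    using insert.prems(2)[of K L] insert.hyps that by auto
  with K(4) have j: "joined K (\<Union>F \<union> Y)" unfolding joined_def by blast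
  have FE: "\<Union>F \<union> Y \<subseteq> E" using insert.prems assms(2) by blast
  show ?case
  proof (cases "K = {}")
    case True
    then show ?thesis using IH by simp
  next
    case False
    have wK: "weight K (card K / s)" and "incidence_rank K = card K"
      using weight_disjoint[OF K(1) False K(3)] by auto
    then have RK: "rank_defect s K = card K" by (simp add: rank_defect_full)
    have less: "card K / real s * 1 < 1" using K(2) by simp
    have "(card K / real s + 1 - 2 * (card K / real s) * 1) / (1 - card K / real s * 1) = 1"
      using less K(2) by simp
    then have "weight (K \<union> (\<Union>F \<union> Y)) 1"
      using weight_joined_less[OF j K(1) FE wK IH(1) less] by simp
    moreover have "rank_defect s (K \<union> (\<Union>F \<union> Y)) = rank_defect s Y + int (card K + card (\<Union>F))"
      using rank_defect_joined_less[OF j K(1) FE wK IH(1) less] RK IH(2) by simp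
    moreover have "card (\<Union>(insert K F)) = card K + card (\<Union>F)"
      using j K(1) FE finite_sub[of K] finite_sub[of "\<Union>F"]
      by (simp add: card_Un_disjoint joined_def Int_Un_distrib)
    ultimately show ?thesis by (simp add: Un_assoc)
  qed
qed

section \<open>Full classes and the net they form\<close>

lemma full_classD:
  assumes "full_class K X"
  shows "K \<subseteq> X" "card K = s" "disjoint K" "\<And>k x. k \<in> K \<Longrightarrow> x \<in> X \<Longrightarrow> x \<notin> K \<Longrightarrow> k \<inter> x \<noteq> {}"
  using assms unfolding full_class_def joined_def by simp_all

text \<open>By equal size, \<open>L\<close> has a member \<open>y\<close> outside \<open>K\<close>.
  If the classes shared an edge \<open>x\<close>, then \<open>y\<close> would meet \<open>x\<close>
  because \<open>K\<close> is full, and miss it because \<open>L\<close> is disjoint.\<close>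

lemma full_class_joined_full_class:
  assumes "full_class K X" "full_class L X" "K \<noteq> L" "X \<subseteq> E"
  shows "joined K L"
proof -
  have fin: "finite K" "finite L" using assms finite_sub by (auto simp: full_class_def)
  have "\<not> L \<subseteq> K"
    using assms fin card_subset_eq[of K L] by (auto simp: full_class_def)
  then obtain y where y: "y \<in> L" "y \<notin> K" by blast
  have "K \<inter> L = {}"
  proof (rule ccontr)
    assume "K \<inter> L \<noteq> {}"
    then obtain x where x: "x \<in> K" "x \<in> L" by blast
    have "x \<inter> y \<noteq> {}"
      using full_classD(4)[OF assms(1) x(1) _ y(2)] full_classD(1)[OF assms(2)] y(1) by auto
    moreover have "x \<inter> y = {}"
      by (rule disjointD[OF full_classD(3)[OF assms(2)] x(2) y(1)]) (use x y in auto)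
    ultimately show False by simp
  qed
  moreover have "x \<inter> y \<noteq> {}" if "x \<in> K" "y \<in> L" for x y
    using full_classD(4)[OF assms(1) that(1)] full_classD(1)[OF assms(2)] that \<open>K \<inter> L = {}\<close> by auto
  ultimately show ?thesis by (simp add: joined_def)
qed

lemma full_class_meets:
  assumes "full_class K X" "x \<in> X - K"
  shows "joined {x} K"
  using full_classD(4)[OF assms(1)] assms(2) by (auto simp: joined_def Int_commute)

lemma full_class_nonempty: "full_class K X \<Longrightarrow> K \<noteq> {}"
  using s_pos unfolding full_class_def by auto

lemma finite_full_classes: "X \<subseteq> E \<Longrightarrow> finite {K. full_class K X}"
  by (rule finite_subset[of _ "Pow X"]) (auto simp: full_class_def finite_sub)

text \<open>The rest \<open>Z\<close> has no full class, since such a class would be full in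
  \<open>X\<close> and belong to \<open>D\<close>. It is controlled because any edge of a full class
  meets all of \<open>Z\<close>. Adding \<open>Z\<close> therefore never lowers the defect: either
  the join is not critical, or \<open>Z\<close> has weight \<open>1\<close> and defect at least
  \<open>s + 1\<close>.\<close>

theorem defect_ge_full_classes:
  assumes "X \<subseteq> E" "P4_free meets X" "D = {K. full_class K X}" "D \<noteq> {}"
  shows "int s + 1 - int (card D) \<le> rank_defect s X"
proof -
  define Z where "Z = X - \<Union>D"
  have fin: "finite D" using finite_full_classes assms by simp
  have DX: "\<Union>D \<subseteq> X" using assms(3) by (auto simp: full_class_def)
  have "weight (\<Union>D) 1 \<and> rank_defect s (\<Union>D) = int s + 1 - int (card D)"
  proof (rule weight_full_classes[OF fin assms(4)])
    show "K \<subseteq> E \<and> card K = s \<and> disjoint K" if "K \<in> D" for K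
      using full_classD(1-3)[of K X] that assms(1,3) by simp
    show "joined K L" if "K \<in> D" "L \<in> D" "K \<noteq> L" for K L
      using full_class_joined_full_class[OF _ _ that(3) assms(1)] that(1,2) assms(3) by simp
  qed
  then have D: "weight (\<Union>D) 1" "rank_defect s (\<Union>D) = int s + 1 - int (card D)"
    by simp_all
  show ?thesis
  proof (cases "Z = {}")
    case True
    then have "\<Union>D = X" using DX Z_def by auto
    then show ?thesis using D by simp
  next
    case False
    have ZE: "Z \<subseteq> E" and DE: "\<Union>D \<subseteq> E" using assms(1) DX by (auto simp: Z_def)
    have j: "joined (\<Union>D) Z"
      using full_classD(4)[of _ X] by (auto simp: joined_def Z_def assms(3))
    obtain K k where K: "K \<in> D" "k \<in> K"
      using assms(3,4) full_class_nonempty by blast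
    have no: "\<not> full_class L Z" for L
    proof
      assume L: "full_class L Z"
      have "l \<inter> x \<noteq> {}" if "l \<in> L" "x \<in> X - L" for l x
      proof (cases "x \<in> Z")
        case True
        then show ?thesis using full_classD(4)[OF L] that by simp
      next
        case False
        then have "x \<in> \<Union>D" "l \<in> Z" using that full_classD(1)[OF L] by (auto simp: Z_def)
        then show ?thesis using joined_sym[OF j] by (auto simp: joined_def)
      qed
      then have "joined L (X - L)" by (auto simp: joined_def)
      moreover have "L \<subseteq> X" using full_classD(1)[OF L] by (auto simp: Z_def)
      ultimately have "L \<in> D"
        using full_classD(2,3)[OF L] by (simp add: assms(3) full_class_def)
      then show False
        using full_class_nonempty[OF L] full_classD(1)[OF L] by (auto simp: Z_def)
    qed
    have "controlled Z"
    proof (rule controlled_if_no_full_class[OF ZE False _ no])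
      show "P4_free meets Z" using assms(2) P4_free_mono[of meets X Z] by (auto simp: Z_def)
      show "k \<in> E" using K DE by blast
      show "joined {k} Z" using j K by (auto simp: joined_def)
    qed
    then obtain t :: real where t: "weight Z t" "0 < t" "real s * min t 2 \<le> rank_defect s Z"
      "0 < rank_defect s Z"
      "t \<le> 1 \<Longrightarrow> rank_defect s Z \<le> s * t \<Longrightarrow> disjoint Z \<and> incidence_rank Z = card Z"
      using controlledE[OF _ ZE False] by metis
    have X: "X = \<Union>D \<union> Z" using DX by (auto simp: Z_def)
    have "1 * t \<le> 1" using weight_joined_le_1[OF j DE ZE False D(1) t(1)] .
    then consider "1 * t < 1" | "1 * t = 1" by linarith
    then show ?thesis
    proof cases
      case 1
      then have "rank_defect s X = rank_defect s (\<Union>D) + rank_defect s Z"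
        using rank_defect_joined_less[OF j DE ZE D(1) t(1)] X by simp
      then show ?thesis using D t by simp
    next
      case 2
      have "\<Union>D \<noteq> {}" using K by blast
      then have "rank_defect s X = rank_defect s (\<Union>D) + rank_defect s Z - (int s + 1)"
        using rank_defect_joined_eq[OF j DE ZE _ D(1) t(1) 2] X by simp
      moreover have "int s + 1 \<le> rank_defect s Z"
        using defect_if_weight_1[OF ZE no] t 2 by auto
      ultimately show ?thesis using D by simp
    qed
  qed
qed

text \<open>Every edge outside a full class is covered by that class, so each full class partitions
  the entire point set; this also gives the number of points.\<close>

theorem net_full_classes:
  assumes "D = {K. full_class K E}" "D \<noteq> {}"
  shows "net s (card D) (\<Union>E) D"
proof -
  have D: "K \<subseteq> E" "card K = s" "disjoint K" "K \<noteq> {}" if "K \<in> D" for K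
    using that full_class_nonempty by (auto simp: assms(1) full_class_def)
  have U: "\<Union>K = \<Union>E" if "K \<in> D" for K
  proof
    show "\<Union>K \<subseteq> \<Union>E" using D that by blast
    have "e \<subseteq> \<Union>K" if "e \<in> E" for e
    proof (cases "e \<in> K")
      case False
      then have "joined {e} K"
        using full_class_meets[of K E e] \<open>K \<in> D\<close> that assms(1) by auto
      then show ?thesis using edge_subset_Union_class D \<open>K \<in> D\<close> that by blast
    qed auto
    then show "\<Union>E \<subseteq> \<Union>K" by blast
  qed
  have part: "partition_on (\<Union>E) K" if "K \<in> D" for K
  proof -
    have "{} \<notin> K" using D(1)[OF that] edge_nonempty by blast
    then show ?thesis using D(3)[OF that] U[OF that] by (simp add: partition_on_def)
  qed
  obtain K where K: "K \<in> D" using assms by blast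
  have "card (\<Union>K) = (\<Sum>k\<in>K. card k)"
    using D[OF K] finite_edge by (intro card_Union_disjoint) auto
  also have "\<dots> = s * s"
    using D[OF K] card_edge by (subst sum.cong[of _ K _ "\<lambda>_. s"]) auto
  finally have "card (\<Union>E) = s\<^sup>2"
    using U[OF K] by (simp add: power2_eq_square)
  moreover have j: "joined K L" if "K \<in> D" "L \<in> D" "K \<noteq> L" for K L
    using that full_class_joined_full_class assms(1) by auto
  then have "disjoint D"
    unfolding disjoint_def joined_def by simp
  moreover have "card (k \<inter> l) = 1" if "K \<in> D" "L \<in> D" "K \<noteq> L" "k \<in> K" "l \<in> L" for K L k l
  proof (rule card_Int_edge)
    show "k \<in> E" "l \<in> E" using that D by blast+
    show "k \<noteq> l" "k \<inter> l \<noteq> {}" using j[OF that(1-3)] that(4,5) unfolding joined_def by auto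
  qed
  moreover have "uniform s (\<Union>D)" "linear_edges (\<Union>D)"
    using uniform_E linear_E D(1) unfolding uniform_def linear_edges_def by blast+
  ultimately show ?thesis
    unfolding net_def using finite_points finite_full_classes[of E] assms(1) part D by auto
qed

end

section \<open>Nets and affine planes\<close>

lemma net_line_subset: "net s a P C \<Longrightarrow> l \<in> \<Union>C \<Longrightarrow> l \<subseteq> P"
  by (auto simp: net_def partition_on_def)

lemma net_line_card: "net s a P C \<Longrightarrow> l \<in> \<Union>C \<Longrightarrow> card l = s"
  by (auto simp: net_def uniform_def)

lemma net_line_at: "net s a P C \<Longrightarrow> K \<in> C \<Longrightarrow> p \<in> P \<Longrightarrow> \<exists>l\<in>K. p \<in> l"
  by (auto simp: net_def partition_on_def)

lemma net_line_unique: "net s a P C \<Longrightarrow> K \<in> C \<Longrightarrow> l \<in> K \<Longrightarrow> m \<in> K \<Longrightarrow> l \<inter> m \<noteq> {} \<Longrightarrow> l = m"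
  unfolding net_def partition_on_def disjoint_def by blast

lemma net_lines_Int: "net s a P C \<Longrightarrow> K \<in> C \<Longrightarrow> L \<in> C \<Longrightarrow> K \<noteq> L \<Longrightarrow> k \<in> K \<Longrightarrow> l \<in> L \<Longrightarrow> card (k \<inter> l) = 1"
  unfolding net_def by blast

lemma net_linear:
  assumes "net s a P C" "l \<in> \<Union>C" "m \<in> \<Union>C" "l \<noteq> m"
  shows "card (l \<inter> m) \<le> 1"
proof -
  have "linear_edges (\<Union>C)" using assms(1) by (simp add: net_def)
  from this[unfolded linear_edges_def, rule_format, OF assms(2-4)] show ?thesis .
qed

lemma net_class_nonempty:
  assumes "net s a P C" "K \<in> C" "0 < s"
  shows "K \<noteq> {}"
  using assms unfolding net_def by fastforce

text \<open>A class consists of any one of its lines together with the lines disjoint from it. Hence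
  the set of lines determines the classes, so that uniqueness of a plane can be checked on
  lines.\<close>

lemma net_classes_eq:
  assumes net: "net s a P C" and "0 < s"
  shows "C = (\<lambda>l. {m \<in> \<Union>C. m = l \<or> m \<inter> l = {}}) ` \<Union>C"
proof -
  have cls: "{m \<in> \<Union>C. m = l \<or> m \<inter> l = {}} = K" if "K \<in> C" "l \<in> K" for K l
  proof
    have "m \<in> K" if m: "m \<in> L" "L \<in> C" "m = l \<or> m \<inter> l = {}" for m L
    proof (rule ccontr)
      assume "m \<notin> K"
      then have "card (m \<inter> l) = 1"
        using net_lines_Int[OF net m(2) \<open>K \<in> C\<close> _ m(1) \<open>l \<in> K\<close>] m by blast
      then show False using m \<open>m \<notin> K\<close> \<open>l \<in> K\<close> by auto
    qed
    then show "{m \<in> \<Union>C. m = l \<or> m \<inter> l = {}} \<subseteq> K" by blast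
    show "K \<subseteq> {m \<in> \<Union>C. m = l \<or> m \<inter> l = {}}"
      using net_line_unique[OF net \<open>K \<in> C\<close> _ \<open>l \<in> K\<close>] that by blast
  qed
  show ?thesis
  proof
    show "C \<subseteq> (\<lambda>l. {m \<in> \<Union>C. m = l \<or> m \<inter> l = {}}) ` \<Union>C"
    proof
      fix K assume K: "K \<in> C"
      then obtain l where l: "l \<in> K" using net_class_nonempty[OF net K assms(2)] by blast
      show "K \<in> (\<lambda>l. {m \<in> \<Union>C. m = l \<or> m \<inter> l = {}}) ` \<Union>C"
        by (rule image_eqI[where x = l]) (use cls[OF K l] K l in auto)
    qed
    show "(\<lambda>l. {m \<in> \<Union>C. m = l \<or> m \<inter> l = {}}) ` \<Union>C \<subseteq> C"
      using cls by auto
  qed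
qed

text \<open>The \<open>s + 1\<close> lines through \<open>p\<close> have \<open>s - 1\<close>
  further points each and share none of them, so together they cover all \<open>s * s - 1\<close>
  points other than \<open>p\<close>.\<close>

lemma affine_plane_line_through:
  assumes plane: "affine_plane s P C" and "0 < s" "p \<in> P" "q \<in> P"
  shows "\<exists>l\<in>\<Union>C. p \<in> l \<and> q \<in> l"
proof (cases "q = p")
  case True
  have "C \<noteq> {}" using plane by (auto simp: affine_plane_def net_def)
  then show ?thesis
    using True net_line_at[of s "s + 1" P C] plane assms(3) unfolding affine_plane_def by blast
next
  case False
  have net: "net s (s + 1) P C" using plane by (simp add: affine_plane_def)
  have fin: "finite P" "card P = s\<^sup>2" "finite C" "card C = s + 1" using net by (auto simp: net_def)
  define line where "line K = (SOME l. l \<in> K \<and> p \<in> l)" for K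
  have line: "line K \<in> K" "p \<in> line K" if "K \<in> C" for K
    using someI_ex[of "\<lambda>l. l \<in> K \<and> p \<in> l"] net_line_at[OF net that assms(3)]
    unfolding line_def by auto
  have sub: "line K \<subseteq> P" "card (line K) = s" if "K \<in> C" for K
    using net_line_subset[OF net] net_line_card[OF net] line(1)[OF that] that by blast+
  have "card (\<Union>K\<in>C. line K - {p}) = (\<Sum>K\<in>C. card (line K - {p}))"
  proof (rule card_UN_disjoint)
    show "\<forall>K\<in>C. \<forall>L\<in>C. K \<noteq> L \<longrightarrow> (line K - {p}) \<inter> (line L - {p}) = {}"
    proof (intro ballI impI)
      fix K L assume KL: "K \<in> C" "L \<in> C" "K \<noteq> L"
      then have "card (line K \<inter> line L) = 1" using net_lines_Int[OF net] line by blast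
      then obtain r where "line K \<inter> line L = {r}" by (auto simp: card_1_singleton_iff)
      moreover have "p \<in> line K \<inter> line L" using line KL by simp
      ultimately show "(line K - {p}) \<inter> (line L - {p}) = {}" by auto
    qed
  qed (use fin sub(1) in \<open>auto intro: finite_subset[OF _ fin(1)]\<close>)
  also have "\<dots> = (\<Sum>K\<in>C. s - 1)"
    using line sub by (intro sum.cong) auto
  also have "\<dots> = (s + 1) * (s - 1)" using fin by simp
  also have "\<dots> = card (P - {p})"
    using fin assms(2,3) by (simp add: power2_eq_square algebra_simps)
  finally have count: "card (\<Union>K\<in>C. line K - {p}) = card (P - {p})" .
  have "(\<Union>K\<in>C. line K - {p}) = P - {p}"
  proof (rule card_subset_eq[OF _ _ count])
    show "(\<Union>K\<in>C. line K - {p}) \<subseteq> P - {p}"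
      by (intro UN_least Diff_mono sub(1) subset_refl)
  qed (use fin(1) in simp)
  moreover have "q \<in> P - {p}" using False assms(4) by simp
  ultimately obtain K where K: "K \<in> C" "q \<in> line K" by auto
  then have "line K \<in> \<Union>C" using line(1) by (intro UnionI[of K])
  then show ?thesis using line(2)[OF K(1)] K(2) by (intro bexI[of _ "line K"] conjI)
qed

text \<open>Bruck's argument: a transversal \<open>e\<close> of the net \<open>D\<close> which is not a line of the completion
  meets each of the \<open>h\<close> remaining lines through one of its points in at most \<open>h - 1\<close> points.\<close>

lemma transversal_in_completion:
  assumes plane: "affine_plane s P C" and D: "D \<subseteq> C" and h: "card (C - D) = h"
    and bound: "(int h - 1)\<^sup>2 < int s"
    and e: "e \<subseteq> P" "card e = s" "\<And>l. l \<in> \<Union>D \<Longrightarrow> card (e \<inter> l) \<le> 1"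
  shows "e \<in> \<Union>C"
proof (rule ccontr)
  assume not: "e \<notin> \<Union>C"
  have net: "net s (s + 1) P C" using plane by (simp add: affine_plane_def)
  have fin: "finite P" "finite C" using net by (auto simp: net_def)
  have s: "0 < s" using bound zero_le_power2[of "int h - 1"] by linarith
  have fin_e: "finite e" using e(1) fin finite_subset by blast
  \<comment> \<open>Lines of \<open>D\<close> contain at most one point of \<open>e\<close>, so the
    line joining two points of \<open>e\<close> comes from one of the other \<open>h\<close>
    classes.\<close>
  have through: "\<exists>K\<in>C - D. \<exists>l\<in>K. x \<in> l \<and> y \<in> l" if xy: "x \<in> e" "y \<in> e" "x \<noteq> y" for x y
  proof -
    obtain l where l: "l \<in> \<Union>C" "x \<in> l" "y \<in> l"
      using affine_plane_line_through[OF plane s] xy e(1) by blast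
    have "{x, y} \<subseteq> e \<inter> l" using l xy by simp
    then have "card {x, y} \<le> card (e \<inter> l)" using fin_e by (intro card_mono) auto
    then have "l \<notin> \<Union>D" using e(3)[of l] xy by fastforce
    with l show ?thesis by blast
  qed
  \<comment> \<open>Fix a point \<open>x\<close> of \<open>e\<close> off \<open>l\<close>. The lines
    joining \<open>x\<close> to the points of \<open>e \<inter> l\<close> lie in different classes,
    as each class has only one line through \<open>x\<close>; the class of \<open>l\<close> does not
    occur, since \<open>x\<close> is not on \<open>l\<close>.\<close>
  have few: "int (card (e \<inter> l)) \<le> int h - 1" if l: "K \<in> C - D" "l \<in> K" for K l
  proof -
    have lC: "l \<in> \<Union>C" using l by blast
    have "\<not> e \<subseteq> l"
      using card_subset_eq[of l e] net_line_card[OF net lC] e(2) lC not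
        finite_subset[OF net_line_subset[OF net lC] fin(1)] by auto
    then obtain x where x: "x \<in> e" "x \<notin> l" by blast
    have "\<forall>q\<in>e \<inter> l. \<exists>L. L \<in> C - D \<and> (\<exists>m\<in>L. x \<in> m \<and> q \<in> m)"
      using through[of x] x by blast
    then obtain g where g: "\<And>q. q \<in> e \<inter> l \<Longrightarrow> g q \<in> C - D \<and> (\<exists>m\<in>g q. x \<in> m \<and> q \<in> m)"
      by metis
    have "inj_on g (e \<inter> l)"
    proof (rule inj_onI)
      fix q r assume q: "q \<in> e \<inter> l" and r: "r \<in> e \<inter> l" and eq: "g q = g r"
      obtain m where m: "m \<in> g q" "x \<in> m" "q \<in> m" using g[OF q] by blast
      obtain n where n: "n \<in> g q" "x \<in> n" "r \<in> n" using g[OF r] eq by auto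
      have gC: "g q \<in> C" using g[OF q] by blast
      then have "m = n" using net_line_unique[OF net gC m(1) n(1)] m n by blast
      then have qr: "{q, r} \<subseteq> m \<inter> l" using m n q r by auto
      have "m \<noteq> l" "m \<in> \<Union>C" using x m gC by auto
      then have "card (m \<inter> l) \<le> 1" using net_linear[OF net _ lC] by blast
      moreover have "finite l" using net_line_subset[OF net lC] fin finite_subset by blast
      then have "card {q, r} \<le> card (m \<inter> l)" using qr by (intro card_mono) auto
      ultimately show "q = r" by (cases "q = r") auto
    qed
    moreover have "g ` (e \<inter> l) \<subseteq> (C - D) - {K}"
    proof
      fix L assume "L \<in> g ` (e \<inter> l)"
      then obtain q where q: "q \<in> e \<inter> l" "L = g q" by blast
      then obtain m where m: "m \<in> L" "x \<in> m" "q \<in> m" "L \<in> C - D" using g by blast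
      have "L \<noteq> K"
      proof
        assume "L = K"
        then have "m = l" using net_line_unique[OF net, of K m l] l m q by blast
        then show False using m x by blast
      qed
      with m show "L \<in> (C - D) - {K}" by blast
    qed
    ultimately have "card (e \<inter> l) \<le> card ((C - D) - {K})"
      using fin by (intro card_inj_on_le) auto
    moreover have "int (card ((C - D) - {K})) = int h - 1"
      using l(1) fin h card_Suc_Diff1[of "C - D" K] by auto
    ultimately show ?thesis by linarith
  qed
  obtain p where p: "p \<in> e" using e(2) s by fastforce
  define line where "line K = (SOME l. l \<in> K \<and> p \<in> l)" for K
  have line: "line K \<in> K" "p \<in> line K" if "K \<in> C" for K
    using someI_ex[of "\<lambda>l. l \<in> K \<and> p \<in> l"] net_line_at[OF net that, of p] p e(1)
    unfolding line_def by auto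
  have "e - {p} \<subseteq> (\<Union>K\<in>C - D. e \<inter> line K - {p})"
  proof
    fix q assume q: "q \<in> e - {p}"
    then obtain K l where K: "K \<in> C - D" "l \<in> K" "p \<in> l" "q \<in> l"
      using through[OF p, of q] by blast
    then have "l = line K" using net_line_unique[OF net, of K l "line K"] line[of K] by blast
    with K q show "q \<in> (\<Union>K\<in>C - D. e \<inter> line K - {p})" by blast
  qed
  then have "card (e - {p}) \<le> card (\<Union>K\<in>C - D. e \<inter> line K - {p})"
    using fin fin_e by (intro card_mono) auto
  also have "\<dots> \<le> (\<Sum>K\<in>C - D. card (e \<inter> line K - {p}))"
    using fin by (intro card_UN_le) auto
  finally have "int (card (e - {p})) \<le> (\<Sum>K\<in>C - D. int (card (e \<inter> line K - {p})))"
    by (metis of_nat_le_iff of_nat_sum)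
  also have "\<dots> \<le> (\<Sum>K\<in>C - D. int h - 2)"
  proof (rule sum_mono)
    fix K assume K: "K \<in> C - D"
    then have "p \<in> e \<inter> line K" using p line by auto
    then have "int (card (e \<inter> line K - {p})) = int (card (e \<inter> line K)) - 1"
      using fin_e card_Suc_Diff1[of "e \<inter> line K" p] by auto
    then show "int (card (e \<inter> line K - {p})) \<le> int h - 2"
      using few[OF K, of "line K"] line K by auto
  qed
  also have "\<dots> = int h * (int h - 2)" using h by simp
  \<comment> \<open>The \<open>s - 1\<close> points of \<open>e\<close> other than \<open>p\<close>
    are spread over \<open>h\<close> lines through \<open>p\<close>, at most \<open>h - 2\<close> on
    each. This amounts to \<open>s \<le> (h - 1)^2\<close>, against \<open>bound\<close>. Integers
    keep \<open>h - 2\<close> meaningful for \<open>h < 2\<close>.\<close>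
  finally have "int s - 1 \<le> int h * (int h - 2)"
    using p fin_e e(2) s card_Suc_Diff1[of e p] by auto
  with bound show False by (simp add: power2_eq_square algebra_simps)
qed

section \<open>Transport of nets along injections\<close>

lemma net_image:
  assumes inj: "inj_on f P" and net: "net s a P C"
  shows "net s a (f ` P) ((`) ((`) f) ` C)"
proof -
  have lines: "\<Union>C \<subseteq> Pow P" and classes: "C \<subseteq> Pow (Pow P)"
    using net_line_subset[OF net] by blast+
  have inj1: "inj_on ((`) f) (Pow P)" using inj by (rule inj_on_image_Pow)
  have inj2: "inj_on ((`) ((`) f)) (Pow (Pow P))" using inj1 by (rule inj_on_image_Pow)
  have U: "\<Union>((`) ((`) f) ` C) = (`) f ` \<Union>C" by blast
  have Int: "f ` k \<inter> f ` l = f ` (k \<inter> l)" if "k \<in> \<Union>C" "l \<in> \<Union>C" for k l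
    using inj_on_image_Int[OF inj] lines that by blast
  have card_f: "card (f ` k) = card k" if "k \<subseteq> P" for k
    using card_image[OF inj_on_subset[OF inj that]] .
  have card_Int: "card (f ` k \<inter> f ` l) = card (k \<inter> l)" if "k \<in> \<Union>C" "l \<in> \<Union>C" for k l
    using Int[OF that] card_f[of "k \<inter> l"] lines that by auto
  have 1: "finite (f ` P)" "card (f ` P) = s\<^sup>2" using net card_f[of P] by (auto simp: net_def)
  have 2: "uniform s (\<Union>((`) ((`) f) ` C))"
    using net card_f lines unfolding U uniform_def net_def by auto
  have 3: "linear_edges (\<Union>((`) ((`) f) ` C))"
    unfolding U linear_edges_def
  proof (intro ballI impI)
    fix x y assume "x \<in> (`) f ` \<Union>C" "y \<in> (`) f ` \<Union>C" "x \<noteq> y"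
    then obtain k l where "k \<in> \<Union>C" "l \<in> \<Union>C" "x = f ` k" "y = f ` l" "k \<noteq> l" by blast
    then show "card (x \<inter> y) \<le> 1" using card_Int[of k l] net_linear[OF net, of k l] by simp
  qed
  have 4: "finite ((`) ((`) f) ` C)" "card ((`) ((`) f) ` C) = a"
    using net card_image[OF inj_on_subset[OF inj2 classes]] by (auto simp: net_def)
  have "disjoint C" using net by (simp add: net_def)
  then have 5: "disjoint ((`) ((`) f) ` C)"
    using disjoint_image[OF inj_on_subset[OF inj1 lines]] by blast
  have 6: "partition_on (f ` P) ((`) f ` K) \<and> card ((`) f ` K) = s" if K: "K \<in> C" for K
  proof -
    have part: "partition_on P K" and cK: "card K = s" using net K by (auto simp: net_def)
    have KP: "K \<subseteq> Pow P" using K classes by blast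
    have "disjoint ((`) f ` K)"
      using part inj by (intro disjoint_image) (auto simp: partition_on_def)
    then have "partition_on (f ` P) ((`) f ` K)"
      using part by (auto simp: partition_on_def)
    then show ?thesis using cK card_image[OF inj_on_subset[OF inj1 KP]] by simp
  qed
  have 7: "card (k \<inter> l) = 1"
    if "K \<in> C" "L \<in> C" "(`) f ` K \<noteq> (`) f ` L" "k \<in> (`) f ` K" "l \<in> (`) f ` L" for K L k l
  proof -
    from that(4,5) obtain k' l' where kl: "k' \<in> K" "l' \<in> L" "k = f ` k'" "l = f ` l'" by auto
    have "K \<noteq> L" using that(3) by auto
    then have "card (k' \<inter> l') = 1" using net_lines_Int[OF net that(1,2)] kl(1,2) by simp
    moreover have "card (f ` k' \<inter> f ` l') = card (k' \<inter> l')"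
      using that(1,2) kl(1,2) by (intro card_Int) auto
    ultimately show ?thesis using kl(3,4) by simp
  qed
  have 8: "\<forall>K\<in>(`) ((`) f) ` C. partition_on (f ` P) K \<and> card K = s"
  proof
    fix K assume "K \<in> (`) ((`) f) ` C"
    then obtain K' where "K' \<in> C" "K = (`) f ` K'" by (elim imageE)
    with 6 show "partition_on (f ` P) K \<and> card K = s" by simp
  qed
  have 9: "\<forall>K\<in>(`) ((`) f) ` C. \<forall>L\<in>(`) ((`) f) ` C. K \<noteq> L \<longrightarrow> (\<forall>k\<in>K. \<forall>l\<in>L. card (k \<inter> l) = 1)"
  proof (intro ballI impI)
    fix K L k l
    assume "K \<in> (`) ((`) f) ` C" "L \<in> (`) ((`) f) ` C" and *: "K \<noteq> L" "k \<in> K" "l \<in> L"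
    then obtain K' L' where "K' \<in> C" "K = (`) f ` K'" "L' \<in> C" "L = (`) f ` L'" by (elim imageE)
    with 7[of K' L' k l] * show "card (k \<inter> l) = 1" by metis
  qed
  show ?thesis
    unfolding net_def by (intro conjI 1 2 3 4 5 8 9)
qed

text \<open>\<open>Comp\<close> quantifies over nets on natural numbers only. The net is encoded by
  an injection, completed there, and the completion is carried back by the inverse, which restores
  the given classes exactly.\<close>

lemma Comp_complete:
  fixes P :: "'a set"
  assumes Comp: "Comp s d" and net: "net s a P C" and "int s + 1 - int a \<le> int d"
  shows "\<exists>C'. affine_plane s P C' \<and> C \<subseteq> C'"
proof -
  have "finite P" using net by (simp add: net_def)
  then obtain f :: "'a \<Rightarrow> nat" where f: "inj_on f P" using finite_imp_inj_to_nat_seg by blast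
  define g where "g = inv_into P f"
  have gf: "g (f x) = x" if "x \<in> P" for x using f that by (simp add: g_def)
  have "net s a (f ` P) ((`) ((`) f) ` C)" using net_image[OF f net] .
  then obtain C' where C': "affine_plane s (f ` P) C'" "(`) ((`) f) ` C \<subseteq> C'"
    using Comp assms(3) unfolding Comp_def by blast
  have "inj_on g (f ` P)" unfolding g_def by (rule inj_on_inv_into) simp
  from net_image[OF this C'(1)[unfolded affine_plane_def]]
  have "affine_plane s (g ` f ` P) ((`) ((`) g) ` C')" by (simp add: affine_plane_def)
  moreover have "g ` f ` P = P" using gf by (force simp: image_image)
  moreover have "C \<subseteq> (`) ((`) g) ` C'"
  proof
    fix K assume K: "K \<in> C"
    have gl: "g ` f ` l = l" if "l \<in> K" for l
    proof -
      have "l \<subseteq> P" using net_line_subset[OF net] that K by blast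
      then show ?thesis using gf by (force simp: image_image)
    qed
    have "K = (`) g ` ((`) f ` K)" using gl by (force simp: image_image)
    then show "K \<in> (`) ((`) g) ` C'" using K C'(2) by blast
  qed
  ultimately show ?thesis by metis
qed

section \<open>Subsystems of affine planes\<close>

text \<open>The \<open>d - h\<close> additional lines are fewer than \<open>s\<close>, so they
  cannot fill one of the remaining classes. From \<open>h \<le> d < s\<close> at least two classes
  are contained in \<open>E\<close>.\<close>

lemma plane_subsystemE:
  assumes "affine_plane s P C" "plane_subsystem s d V E P C h" "d < s" "finite E"
  obtains D where "D \<subseteq> C" "D \<noteq> {}" "card D = s + 1 - h" "2 \<le> card D" "\<Union>D \<subseteq> E" "E \<subseteq> \<Union>C" "h \<le> d"
    "card (E \<inter> \<Union>(C - D)) = d - h" "\<And>K. K \<in> C - D \<Longrightarrow> \<not> K \<subseteq> E"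
proof -
  from assms(2) obtain D where D: "D \<subseteq> C" "card D = s + 1 - h" "\<Union>D \<subseteq> E"
      "card (E \<inter> \<Union>(C - D)) = d - h" and E: "E \<subseteq> \<Union>C" "h \<le> d"
    unfolding plane_subsystem_def by auto
  have "\<not> K \<subseteq> E" if K: "K \<in> C - D" for K
  proof
    assume "K \<subseteq> E"
    then have "K \<subseteq> E \<inter> \<Union>(C - D)" using K by auto
    then have "card K \<le> d - h" using card_mono[of "E \<inter> \<Union>(C - D)" K] D(4) assms(4) by simp
    moreover have "card K = s" using assms(1) K by (simp add: affine_plane_def net_def)
    ultimately show False using assms(3) by simp
  qed
  moreover have "2 \<le> card D" using D(2) E(2) assms(3) by simp
  moreover from this have "D \<noteq> {}" by auto
  ultimately show thesis using that[of D] D E by blast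
qed

text \<open>The square is monotone in \<open>h\<close> only from \<open>h = 1\<close> on. For
  \<open>h = 0\<close> it equals \<open>1\<close>, and \<open>s > 1\<close> comes from the bound in
  \<open>Comp\<close> if \<open>d = 0\<close> and from \<open>d < s\<close> otherwise.\<close>

lemma Comp_bound:
  assumes "Comp s d" "d < s" "h \<le> d"
  shows "(int h - 1)\<^sup>2 < int s"
proof (cases "h = 0")
  case True
  have "1 < s"
  proof (cases "d = 0")
    case True
    then show ?thesis using assms(1) by (simp add: Comp_def)
  qed (use assms(2) in simp)
  then show ?thesis using True by simp
next
  case False
  then have "(int h - 1)\<^sup>2 \<le> (int d - 1)\<^sup>2" using assms(3) by (intro power_mono) auto
  then show ?thesis using assms(1) by (simp add: Comp_def)
qed

context uniform_linear
begin

lemma net_classes_joined: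
  assumes "net s a P C" "K \<in> C" "L \<in> C" "K \<noteq> L"
  shows "joined K L"
proof -
  have "disjoint C" using assms(1) by (simp add: net_def)
  then have "K \<inter> L = {}" using assms(2-4) by (rule disjointD)
  moreover have "k \<inter> l \<noteq> {}" if "k \<in> K" "l \<in> L" for k l
    using net_lines_Int[OF assms that] by auto
  ultimately show ?thesis by (simp add: joined_def)
qed

lemma net_class:
  assumes "net s a P C" "K \<in> C"
  shows "card K = s" "disjoint K"
  using assms by (auto simp: net_def partition_on_def)

lemma net_class_full:
  assumes net: "net s a P C" and "K \<in> C" "K \<subseteq> E" "E \<subseteq> \<Union>C"
  shows "full_class K E"
proof -
  have "k \<inter> x \<noteq> {}" if k: "k \<in> K" and x: "x \<in> E - K" for k x
  proof -
    obtain L where L: "L \<in> C" "x \<in> L" using x assms(4) by auto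
    then have "joined K L" using net_classes_joined[OF net assms(2)] x by auto
    then show ?thesis using k L by (simp add: joined_def)
  qed
  then have "joined K (E - K)" by (simp add: joined_def)
  then show ?thesis using net_class[OF net assms(2)] assms(3) by (simp add: full_class_def)
qed

text \<open>Members of a full class are disjoint, and disjoint lines of a net are parallel; by its
  size a full class is thus an entire class of the net. Hence \<open>D\<close> depends on
  \<open>E\<close> alone, which the uniqueness of the plane rests on.\<close>

lemma full_classes_eq:
  assumes net: "net s a P C" and D: "D \<subseteq> C" "\<Union>D \<subseteq> E" and E: "E \<subseteq> \<Union>C"
    and no: "\<And>K. K \<in> C - D \<Longrightarrow> \<not> K \<subseteq> E"
  shows "{K. full_class K E} = D"
proof (intro subset_antisym subsetI)
  fix K assume "K \<in> D"
  then show "K \<in> {K. full_class K E}" using net_class_full[OF net _ _ E] D by auto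
next
  fix K assume "K \<in> {K. full_class K E}"
  then have K: "full_class K E" by simp
  obtain k where k: "k \<in> K" using full_class_nonempty[OF K] by auto
  then have "k \<in> \<Union>C" using full_classD(1)[OF K] E by auto
  then obtain L where L: "L \<in> C" "k \<in> L" by auto
  have "K \<subseteq> L"
  proof
    fix x assume x: "x \<in> K"
    then have "x \<in> \<Union>C" using full_classD(1)[OF K] E by auto
    then obtain M where M: "M \<in> C" "x \<in> M" by auto
    have "M = L"
    proof (rule ccontr)
      assume "M \<noteq> L"
      then have 1: "card (x \<inter> k) = 1" using net_lines_Int[OF net M(1) L(1) _ M(2) L(2)] by simp
      show False
      proof (cases "x = k")
        case True
        moreover have "disjoint C" using net by (simp add: net_def)
        then have "M \<inter> L = {}" by (rule disjointD) (use M L \<open>M \<noteq> L\<close> in auto)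
        ultimately show False using M L by auto
      next
        case False
        then have "x \<inter> k = {}" by (rule disjointD[OF full_classD(3)[OF K] x k])
        then show False using 1 by simp
      qed
    qed
    with M show "x \<in> L" by simp
  qed
  moreover have "card L = s" using net_class[OF net L(1)] by simp
  moreover have "finite L" using \<open>card L = s\<close> s_pos card_ge_0_finite by metis
  ultimately have "K = L" using full_classD(2)[OF K] by (intro card_subset_eq) auto
  then show "K \<in> D" using no[of L] L full_classD(1)[OF K] by auto
qed

lemma rank_defect_subsystem:
  assumes net: "net s a P C" and D: "D \<subseteq> C" "D \<noteq> {}" "\<Union>D \<subseteq> E" and E: "E \<subseteq> \<Union>C"
    and no: "\<And>K. K \<in> C - D \<Longrightarrow> \<not> K \<subseteq> E"
  shows "rank_defect s E = int s + 1 - int (card D) + int (card (E \<inter> \<Union>(C - D)))"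
proof -
  have fin: "finite C" "finite D" using net finite_subset[OF D(1)] by (auto simp: net_def)
  have full: "weight (\<Union>D) 1 \<and> rank_defect s (\<Union>D) = int s + 1 - int (card D)"
  proof (rule weight_full_classes[OF fin(2) D(2)])
    show "K \<subseteq> E \<and> card K = s \<and> disjoint K" if "K \<in> D" for K
      using net_class[OF net, of K] that D by auto
    show "joined K L" if "K \<in> D" "L \<in> D" "K \<noteq> L" for K L
      using net_classes_joined[OF net _ _ that(3)] that(1,2) D by auto
  qed
  \<comment> \<open>The traces of the remaining classes on \<open>E\<close>. Several classes may
    have the same, empty trace; they collapse to one member of \<open>F\<close>, and distinct
    members still come from distinct classes.\<close>
  define F where "F = (\<lambda>K. K \<inter> E) ` (C - D)"
  have "weight (\<Union>F \<union> \<Union>D) 1 \<and> rank_defect s (\<Union>F \<union> \<Union>D) = rank_defect s (\<Union>D) + int (card (\<Union>F))"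
  proof (rule rank_defect_partial_classes)
    show "finite F" using fin by (simp add: F_def)
    show "\<Union>D \<subseteq> E" by fact
    show "weight (\<Union>D) 1" using full by simp
  next
    fix A assume "A \<in> F"
    then obtain K where K: "K \<in> C - D" "A = K \<inter> E" by (auto simp: F_def)
    have "finite K" using net_class(1)[OF net, of K] K s_pos card_ge_0_finite[of K] by auto
    moreover have "K \<inter> E \<subset> K" using no[OF K(1)] by auto
    ultimately have "card A < s"
      using psubset_card_mono[of K "K \<inter> E"] net_class(1)[OF net, of K] K by simp
    moreover have "disjoint A"
      using net_class(2)[OF net, of K] K by (auto intro: pairwise_subset)
    moreover have "joined A (\<Union>D)"
    proof -
      have "joined K L" if "L \<in> D" for L
        using net_classes_joined[OF net, of K L] that K(1) D(1) by auto
      then show ?thesis by (auto simp: joined_def K(2))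
    qed
    ultimately show "A \<subseteq> E \<and> card A < s \<and> disjoint A \<and> joined A (\<Union>D)" using K by simp
  next
    fix A B assume "A \<in> F" "B \<in> F" "A \<noteq> B"
    then obtain K L where KL: "K \<in> C" "L \<in> C" "K \<noteq> L" "A = K \<inter> E" "B = L \<inter> E"
      by (auto simp: F_def)
    show "joined A B"
      unfolding KL(4,5) by (rule joined_mono[OF net_classes_joined[OF net KL(1-3)]]) auto
  qed
  moreover have "\<Union>F = E \<inter> \<Union>(C - D)" by (auto simp: F_def)
  moreover have "E \<inter> \<Union>(C - D) \<union> \<Union>D = E" using D(3) E by blast
  ultimately show ?thesis using full by simp
qed

lemma subsystem_points:
  assumes "net s a P C" "D \<subseteq> C" "D \<noteq> {}" "\<Union>D \<subseteq> E" "E \<subseteq> \<Union>C"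
  shows "P = \<Union>E"
proof
  obtain K where "K \<in> D" using assms(3) by auto
  moreover from this have "\<Union>K = P" using assms(1,2) by (auto simp: net_def partition_on_def)
  ultimately show "P \<subseteq> \<Union>E" using assms(4) by auto
  show "\<Union>E \<subseteq> P"
  proof (rule Union_least)
    fix e assume "e \<in> E"
    then have "e \<in> \<Union>C" using assms(5) by (rule rev_subsetD)
    then show "e \<subseteq> P" by (rule net_line_subset[OF assms(1)])
  qed
qed

text \<open>A line of the second plane outside the shared classes meets each of their lines at most
  once, so it is a transversal to which Bruck's count applies.\<close>

lemma completion_lines_subset:
  assumes C: "affine_plane s P C" and C': "affine_plane s P C'" and D: "D \<subseteq> C" "D \<subseteq> C'"
    and "(int (card (C - D)) - 1)\<^sup>2 < int s"
  shows "\<Union>C' \<subseteq> \<Union>C"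
proof
  fix e assume e: "e \<in> \<Union>C'"
  have net: "net s (s + 1) P C'" using C' by (simp add: affine_plane_def)
  show "e \<in> \<Union>C"
  proof (cases "e \<in> \<Union>D")
    case True
    then show ?thesis using D(1) by auto
  next
    case False
    show ?thesis
    proof (rule transversal_in_completion[OF C D(1) refl assms(5)])
      show "e \<subseteq> P" "card e = s" using net_line_subset[OF net e] net_line_card[OF net e] by auto
      fix l assume l: "l \<in> \<Union>D"
      then have "l \<in> \<Union>C'" "e \<noteq> l" using D(2) False by auto
      then show "card (e \<inter> l) \<le> 1" using net_linear[OF net e] by simp
    qed
  qed
qed

text \<open>In either plane the contained classes are the full classes of \<open>E\<close>, so both
  planes complete the same net on the same points. Their lines agree by
  \<open>completion_lines_subset\<close> in both directions, and the lines determine the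
  classes.\<close>

lemma plane_subsystem_unique:
  assumes "Comp s d" "d < s"
    and "affine_plane s P C" "plane_subsystem s d V E P C h"
    and "affine_plane s P' C'" "plane_subsystem s d V E P' C' h'"
  shows "P' = P \<and> C' = C"
proof -
  obtain D where D: "D \<subseteq> C" "D \<noteq> {}" "card D = s + 1 - h" "\<Union>D \<subseteq> E" "E \<subseteq> \<Union>C" "h \<le> d"
    "\<And>K. K \<in> C - D \<Longrightarrow> \<not> K \<subseteq> E"
    using plane_subsystemE[OF assms(3,4,2) finite_E] by metis
  obtain D' where D': "D' \<subseteq> C'" "D' \<noteq> {}" "card D' = s + 1 - h'" "\<Union>D' \<subseteq> E" "E \<subseteq> \<Union>C'" "h' \<le> d"
    "\<And>K. K \<in> C' - D' \<Longrightarrow> \<not> K \<subseteq> E"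
    using plane_subsystemE[OF assms(5,6,2) finite_E] by metis
  have net: "net s (s + 1) P C" and net': "net s (s + 1) P' C'"
    using assms by (auto simp: affine_plane_def)
  have P: "P' = P"
    using subsystem_points[OF net D(1,2,4,5)] subsystem_points[OF net' D'(1,2,4,5)] by simp
  have DD: "D' = D"
    using full_classes_eq[OF net D(1,4,5,7)] full_classes_eq[OF net' D'(1,4,5,7)] by simp
  have fin: "finite C" "finite C'" "card C = s + 1" "card C' = s + 1"
    using net net' by (auto simp: net_def)
  have "card (C - D) = h" "card (C' - D) = h'"
    using card_Diff_subset[of D C] card_Diff_subset[of D C'] D(1,3,6) D'(1,3,6) DD fin assms(2)
      finite_subset[of D C] by auto
  then have "(int (card (C - D)) - 1)\<^sup>2 < int s" "(int (card (C' - D)) - 1)\<^sup>2 < int s"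
    using Comp_bound[OF assms(1,2)] D(6) D'(6) by auto
  then have "\<Union>C' \<subseteq> \<Union>C" "\<Union>C \<subseteq> \<Union>C'"
    using completion_lines_subset[of P C C' D] completion_lines_subset[of P C' C D]
      assms(3,5) P D(1) D'(1) DD by auto
  then have "\<Union>C' = \<Union>C" by auto
  then show ?thesis
    using net_classes_eq[OF net s_pos] net_classes_eq[OF net' s_pos] P by simp
qed

text \<open>The lower bound for the defect says that the net of full classes has deficiency at most
  \<open>d\<close>, so it can be completed. Once all edges are known to be lines of the completion,
  the exact formula \<open>rank_defect_subsystem\<close> yields the number \<open>d - h\<close> of
  additional lines.\<close>

lemma plane_subsystem_exists:
  assumes "Comp s d" "d < s" "rank_defect s E = int d" "P4_free meets E"
    and "full_class K E"
  shows "\<exists>C h. affine_plane s (\<Union>E) C \<and> plane_subsystem s d (\<Union>E) E (\<Union>E) C h"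
proof -
  define D where "D = {K. full_class K E}"
  have D0: "D \<noteq> {}" using assms(5) by (auto simp: D_def)
  have b: "int s + 1 - int (card D) \<le> int d"
    using defect_ge_full_classes[OF _ assms(4) D_def D0] assms(3) by simp
  have "net s (card D) (\<Union>E) D" using net_full_classes[OF D_def D0] .
  from Comp_complete[OF assms(1) this b]
  obtain C where C: "affine_plane s (\<Union>E) C" and DC: "D \<subseteq> C" by blast
  have net: "net s (s + 1) (\<Union>E) C" using C by (simp add: affine_plane_def)
  have fin: "finite C" "card C = s + 1" using net by (auto simp: net_def)
  define h where "h = card (C - D)"
  have cardD: "card D + h = s + 1"
    using fin DC card_mono[OF fin(1) DC] card_Diff_subset[of D C] finite_subset[OF DC fin(1)]
    by (simp add: h_def)
  then have hd: "h \<le> d" using b by linarith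
  have DE: "\<Union>D \<subseteq> E" using full_classD(1) by (auto simp: D_def)
  have EC: "E \<subseteq> \<Union>C"
  proof
    fix e assume e: "e \<in> E"
    show "e \<in> \<Union>C"
    proof (cases "e \<in> \<Union>D")
      case True
      then show ?thesis using DC by auto
    next
      case False
      show ?thesis
      proof (rule transversal_in_completion[OF C DC h_def[symmetric] Comp_bound[OF assms(1,2) hd]])
        show "e \<subseteq> \<Union>E" "card e = s" using e card_edge by auto
        fix l assume l: "l \<in> \<Union>D"
        then have "l \<in> E" "e \<noteq> l" using DE False by auto
        then show "card (e \<inter> l) \<le> 1" using linear_E e by (simp add: linear_edges_def)
      qed
    qed
  qed
  have no: "\<not> K \<subseteq> E" if "K \<in> C - D" for K
    using net_class_full[OF net _ _ EC, of K] that by (auto simp: D_def)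
  have "int d = int s + 1 - int (card D) + int (card (E \<inter> \<Union>(C - D)))"
    using rank_defect_subsystem[OF net DC D0 DE EC no] assms(3) by simp
  then have rest: "card (E \<inter> \<Union>(C - D)) = d - h" using cardD hd by linarith
  have h0: "C = D" if "h = 0"
    using that fin DC by (auto simp: h_def)
  have "plane_subsystem s d (\<Union>E) E (\<Union>E) C h"
    unfolding plane_subsystem_def
  proof (intro conjI impI)
    show "\<exists>D\<subseteq>C. card D = s + 1 - h \<and> \<Union>D \<subseteq> E \<and> card (E \<inter> \<Union>(C - D)) = d - h"
      using DC cardD DE rest by (intro exI[of _ D]) simp
    \<comment> \<open>If \<open>h = 0\<close>, all lines of the plane belong to \<open>D\<close>,
      which leaves no room for \<open>d\<close> additional ones.\<close>
    show "1 \<le> h" if "0 < d"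
    proof (rule ccontr)
      assume "\<not> 1 \<le> h"
      then have "h = 0" by simp
      then show False using rest h0 that by simp
    qed
    show "h = 0" if "d = 0" using hd that by simp
    then show "E = \<Union>C" if "d = 0" using h0 DE EC that by auto
  qed (use hd EC in auto)
  then show ?thesis using C by blast
qed

end

section \<open>The classification\<close>

lemma P4_free_line_graph:
  assumes "cograph E (line_graph E)"
  shows "P4_free meets E"
  unfolding P4_free_def
proof
  assume "\<exists>a\<in>E. \<exists>b\<in>E. \<exists>c\<in>E. \<exists>d\<in>E. distinct [a, b, c, d] \<and>
    meets a b \<and> meets b c \<and> meets c d \<and> \<not> meets a c \<and> \<not> meets a d \<and> \<not> meets b d"
  then obtain a b c d where "a \<in> E" "b \<in> E" "c \<in> E" "d \<in> E" "distinct [a, b, c, d]"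
    "meets a b \<and> meets b c \<and> meets c d \<and> \<not> meets a c \<and> \<not> meets a d \<and> \<not> meets b d"
    by (elim bexE conjE) simp
  then have "(a, b) \<in> line_graph E \<and> (b, c) \<in> line_graph E \<and> (c, d) \<in> line_graph E \<and>
      (a, c) \<notin> line_graph E \<and> (a, d) \<notin> line_graph E \<and> (b, d) \<notin> line_graph E"
    by (simp add: line_graph_def)
  with \<open>a \<in> E\<close> \<open>b \<in> E\<close> \<open>c \<in> E\<close> \<open>d \<in> E\<close> \<open>distinct [a, b, c, d]\<close> assms show False
    unfolding cograph_def by blast
qed

lemma connected_not_splits:
  assumes "connected_graph E (line_graph E)"
  shows "\<not> splits meets E"
proof
  assume "splits meets E"
  then obtain A B where AB: "A \<noteq> {}" "B \<noteq> {}" "A \<inter> B = {}" "A \<union> B = E"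
      "\<forall>a\<in>A. \<forall>b\<in>B. \<not> meets a b"
    unfolding splits_def by (elim exE conjE)
  obtain a b where ab: "a \<in> A" "b \<in> B" using AB by auto
  then have "(a, b) \<in> (line_graph E)\<^sup>*"
    using assms AB(4) unfolding connected_graph_def by auto
  then have "b \<in> A"
  proof (induction rule: rtrancl_induct)
    case (step y z)
    then have "z \<in> E" "meets y z" by (auto simp: line_graph_def)
    then show ?case using AB(4,5) step.IH by auto
  qed (use ab in simp)
  with ab AB(3) show False by auto
qed

theorem theorem5p2:
  fixes s d :: nat and V :: "'a set" and E :: "'a set set"
  assumes "d < s" and "Comp s d"
    and "hypergraph V E" and "E \<noteq> {}" and "connected_hypergraph V E"
    and "linear_edges E" and "uniform s E" and "cograph E (line_graph E)"
  shows "(rank_defect s E = int d \<longrightarrow>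
            (let case1 = full_row_rank d E;
                 case2 = (\<exists>!(P, C). affine_plane s P C \<and> (\<exists>h. plane_subsystem s d V E P C h))
             in (case1 \<or> case2) \<and> \<not> (case1 \<and> case2))) \<and>
         (full_row_rank d E \<or>
            (\<exists>P C h. affine_plane s P C \<and> plane_subsystem s d V E P C h) \<longrightarrow>
          rank_defect s E = int d)"
proof -
  have "finite (\<Union>E)" using assms(3) finite_subset by (auto simp: hypergraph_def)
  then have finE: "finite E" by (rule finite_UnionD)
  interpret uniform_linear s E
    using finE assms by unfold_locales auto
  have V: "V = \<Union>E" using assms(5) by (simp add: connected_hypergraph_def)
  have P4: "P4_free meets E" using P4_free_line_graph assms(8) by blast
  have nosplit: "\<not> splits meets E"
    using connected_not_splits assms(5) by (auto simp: connected_hypergraph_def)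
  let ?case2 = "\<exists>!(P, C). affine_plane s P C \<and> (\<exists>h. plane_subsystem s d V E P C h)"
  have unique: ?case2 if "affine_plane s P C" "plane_subsystem s d V E P C h" for P C h
  proof (rule ex1I[of _ "(P, C)"])
    show "case (P, C) of (P, C) \<Rightarrow> affine_plane s P C \<and> (\<exists>h. plane_subsystem s d V E P C h)"
      using that by auto
    fix x assume "case x of (P, C) \<Rightarrow> affine_plane s P C \<and> (\<exists>h. plane_subsystem s d V E P C h)"
    then show "x = (P, C)"
      using plane_subsystem_unique[OF assms(2,1) that] by auto
  qed
  \<comment> \<open>A single contained class already has \<open>s > d\<close> edges.\<close>
  have exclusive: False
    if asm: "full_row_rank d E" "affine_plane s P C" "plane_subsystem s d V E P C h" for P C h
  proof -
    obtain D where D: "D \<subseteq> C" "D \<noteq> {}" "\<Union>D \<subseteq> E"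
      using plane_subsystemE[OF asm(2,3) assms(1) finE] by metis
    then obtain K where K: "K \<in> D" by auto
    with asm(2) D(1) have "card K = s" by (auto simp: affine_plane_def net_def)
    moreover have "card K \<le> card E" using K D(3) finE by (intro card_mono) auto
    ultimately show False using asm(1) assms(1) by (simp add: full_row_rank_def)
  qed
  have either: "full_row_rank d E \<or> ?case2" if R: "rank_defect s E = int d"
  proof (cases "incidence_rank E = card E")
    case True
    then have "full_row_rank d E"
      using R rank_defect_full[of E] by (simp add: full_row_rank_def)
    then show ?thesis ..
  next
    case False
    then have less: "incidence_rank E < card E"
      using incidence_rank_le_card[OF finE] by simp
    have "2 \<le> card E"
    proof (rule ccontr)
      assume "\<not> 2 \<le> card E"
      moreover have "card E \<noteq> 0" using assms(4) finE by simp
      ultimately have "card E = 1" by linarith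
      then obtain e where "E = {e}" by (auto simp: card_1_singleton_iff)
      then show False using incidence_rank_singleton[of e] less by simp
    qed
    then have "splits meets E \<or> splits (\<lambda>x y. \<not> meets x y) E"
      by (intro cograph_splits P4 finE) (simp_all add: Int_commute)
    with nosplit have "splits (\<lambda>x y. \<not> meets x y) E" by simp
    then obtain A B where AB: "A \<noteq> {}" "B \<noteq> {}" "A \<inter> B = {}" "A \<union> B = E"
        "\<forall>a\<in>A. \<forall>b\<in>B. \<not> \<not> meets a b"
      unfolding splits_def by (elim exE conjE)
    then have j: "joined A B" by (simp add: joined_def)
    \<comment> \<open>Otherwise the dependent rows would force a defect of at least
      \<open>s\<close>, whereas it is \<open>d < s\<close>.\<close>
    obtain K where "full_class K E"
      using defect_if_no_full_class[OF subset_refl P4 _ AB(1,2,4) j less] R assms(1) by fastforce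
    then obtain C h where "affine_plane s V C" "plane_subsystem s d V E V C h"
      using plane_subsystem_exists[OF assms(2,1) R P4] V by metis
    then show ?thesis using unique by blast
  qed
  have converse: "rank_defect s E = int d"
    if asm: "affine_plane s P C" "plane_subsystem s d V E P C h" for P C h
  proof -
    obtain D where D: "D \<subseteq> C" "D \<noteq> {}" "card D = s + 1 - h" "\<Union>D \<subseteq> E" "E \<subseteq> \<Union>C" "h \<le> d"
      "card (E \<inter> \<Union>(C - D)) = d - h" "\<And>K. K \<in> C - D \<Longrightarrow> \<not> K \<subseteq> E"
      using plane_subsystemE[OF asm assms(1) finE] by metis
    have "net s (s + 1) P C" using asm(1) by (simp add: affine_plane_def)
    from rank_defect_subsystem[OF this D(1,2,4,5,8)] show ?thesis
      using D(3,6,7) assms(1) by (simp add: of_nat_diff)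
  qed
  have "rank_defect s E = int d" if "full_row_rank d E"
    using that rank_defect_full[of E] by (simp add: full_row_rank_def)
  moreover have "\<not> (full_row_rank d E \<and> ?case2)"
  proof
    assume *: "full_row_rank d E \<and> ?case2"
    then obtain x where "case x of (P, C) \<Rightarrow> affine_plane s P C \<and> (\<exists>h. plane_subsystem s d V E P C h)"
      by (blast elim: ex1E)
    then show False using exclusive * by (auto split: prod.splits)
  qed
  ultimately show ?thesis
    unfolding Let_def using either converse by blast
qed

end
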